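(* Let $f$ be a square-integrable function, let $\hat{\mathbf U}=[\hat{\mathbf U}_1\ \hat{\mathbf U}_2]$ be a $d\times d$ orthogonal matrix with $\hat{\mathbf U}_1\in\mathbb R^{d\times d_1}$, $1\le d_1<d$, and put $\hat{\mathbf w}_1=\hat{\mathbf U}_1^T\mathbf z$, $\hat{\mathbf w}_2=\hat{\mathbf U}_2^T\mathbf z$. Let $$\hat F_{gas}(\mathbf z)=\int f(\hat{\mathbf U}_1\hat{\mathbf w}_1+\hat{\mathbf U}_2\mathbf u)\,\hat\pi_{\hat{\mathbf w}_2|\hat{\mathbf w}_1}(\mathbf u|\hat{\mathbf w}_1)\,d\mathbf u$$ and let $$\hat F_{mc}(\mathbf z)=\frac1{N_1}\sum_{i=1}^{N_1}f(\hat{\mathbf U}_1\hat{\mathbf w}_1+\hat{\mathbf U}_2\hat{\mathbf u}^{(i)}),$$ where, given $\hat{\mathbf w}_1$, $\hat{\mathbf u}^{(1)},\dots,\hat{\mathbf u}^{(N_1)}$ are sampled independently from $\hat\pi_{\hat{\mathbf w}_2|\hat{\mathbf w}_1}$. Then the mean squared error of $\hat F_{mc}$ satisfies $$\mathbb E[(\hat F_{mc}-f)^2]^{\frac12}\le\left(1+\frac1{\sqrt{N_1}}\right)\mathbb E[(\hat F_{gas}-f)^2]^{\frac12}.$$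
   Context: Setting: $\mathbb R^d$ carries the probability measure induced by a cumulative distribution function $\mathbf F(\mathbf z)=F_1(z_1)\cdots F_d(z_d)$ with probability density $\rho$; $f$ is a real-valued function on $\Omega\subseteq\mathbb R^d$ with $\mathbf F$ concentrated on $\Omega$, and all points at which $f$ is evaluated are assumed to lie in $\Omega$ (e.g. $\Omega=\mathbb R^d$). $\mathbf z$ has distribution $\mathbf F$. $\hat\pi(\hat{\mathbf w}_1,\hat{\mathbf w}_2)=\rho(\hat{\mathbf U}_1\hat{\mathbf w}_1+\hat{\mathbf U}_2\hat{\mathbf w}_2)$ is the joint density of $(\hat{\mathbf w}_1,\hat{\mathbf w}_2)$ and $\hat\pi_{\hat{\mathbf w}_2|\hat{\mathbf w}_1}$ is the conditional density of $\hat{\mathbf w}_2$ given $\hat{\mathbf w}_1$. In the paper $\hat{\mathbf U}$ is the estimated eigenvector matrix of the global active subspace method; here it is treated as fixed. Expectations are over $\mathbf z$ and, where present, the Monte Carlo samples $\hat{\mathbf u}^{(i)}$. *)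

theory Defs
  imports "HOL-Probability.Probability"
begin

section \<open>Product distributions with a density\<close>

definition univariate_cdf :: "(real \<Rightarrow> real) \<Rightarrow> bool" where
  "univariate_cdf G \<longleftrightarrow> (\<exists>\<nu>. real_distribution \<nu> \<and> G = cdf \<nu>)"

text \<open>\<open>P\<close> is the probability measure with CDF \<open>z \<mapsto> F\<^sub>1(z\<^sub>1) \<cdots> F\<^sub>d(z\<^sub>d)\<close>,
  \<open>d = CARD('d)\<close>, and \<open>\<rho>\<close> is a Lebesgue density of it.\<close>

definition product_distribution ::
    "(real^'d) measure \<Rightarrow> ('d \<Rightarrow> real \<Rightarrow> real) \<Rightarrow> (real^'d \<Rightarrow> real) \<Rightarrow> bool" where
  "product_distribution P F \<rho> \<longleftrightarrow>
     prob_space P \<and> sets P = sets borel \<and>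
     (\<forall>i. univariate_cdf (F i)) \<and>
     (\<forall>z. measure P {x. \<forall>i. x $ i \<le> z $ i} = (\<Prod>i\<in>UNIV. F i (z $ i))) \<and>
     \<rho> \<in> borel_measurable borel \<and> (\<forall>x. 0 \<le> \<rho> x) \<and>
     P = density lborel (\<lambda>x. ennreal (\<rho> x))"

text \<open>\<open>f\<close> is a function on \<open>\<Omega>\<close>; its values outside \<open>\<Omega>\<close> carry no meaning and nothing is
  assumed about them.\<close>

definition square_integrable_on ::
    "(real^'d) measure \<Rightarrow> (real^'d) set \<Rightarrow> (real^'d \<Rightarrow> real) \<Rightarrow> bool" where
  "square_integrable_on P \<Omega> f \<longleftrightarrow>
     f \<in> borel_measurable (restrict_space borel \<Omega>) \<and> set_integrable P \<Omega> (\<lambda>x. (f x)\<^sup>2)"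

section \<open>Splitting the coordinates by an orthogonal matrix\<close>

text \<open>The block matrix \<open>[U\<^sub>1 U\<^sub>2]\<close>; columns are indexed by the disjoint union of the two
  column index types.\<close>

definition block_cols :: "real^'d1^'d \<Rightarrow> real^'d2^'d \<Rightarrow> real^('d1 + 'd2)^'d" where
  "block_cols U1 U2 = (\<chi> i j. case j of Inl a \<Rightarrow> U1 $ i $ a | Inr b \<Rightarrow> U2 $ i $ b)"

text \<open>The two equations of \<^const>\<open>orthogonal_matrix\<close>, which cannot be used itself because its
  type requires rows and columns to be indexed by the same type. Together they force
  \<open>CARD('d1) + CARD('d2) = CARD('d)\<close>; as types are nonempty, \<open>d\<^sub>1 = CARD('d1)\<close> then satisfies
  \<open>1 \<le> d\<^sub>1 < d\<close>, and every such pair \<open>(d\<^sub>1, d)\<close> arises.\<close>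

definition orthogonal_blocks :: "real^'d1^'d \<Rightarrow> real^'d2^'d \<Rightarrow> bool" where
  "orthogonal_blocks U1 U2 \<longleftrightarrow>
     transpose (block_cols U1 U2) ** block_cols U1 U2 = mat 1 \<and>
     block_cols U1 U2 ** transpose (block_cols U1 U2) = mat 1"

definition joint_density ::
    "real^'d1^'d \<Rightarrow> real^'d2^'d \<Rightarrow> (real^'d \<Rightarrow> real) \<Rightarrow> real^'d1 \<Rightarrow> real^'d2 \<Rightarrow> real" where
  "joint_density U1 U2 \<rho> w1 w2 = \<rho> (U1 *v w1 + U2 *v w2)"

text \<open>Joint density over marginal density. Where the marginal is \<open>0\<close> or the integral diverges
  (a null event for \<open>w\<^sub>1\<close>) the value is \<open>0\<close> by the convention \<open>x / 0 = 0\<close>.\<close>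

definition cond_density ::
    "real^'d1^'d \<Rightarrow> real^'d2^'d \<Rightarrow> (real^'d \<Rightarrow> real) \<Rightarrow> real^'d1 \<Rightarrow> real^'d2 \<Rightarrow> real" where
  "cond_density U1 U2 \<rho> w1 w2 =
     joint_density U1 U2 \<rho> w1 w2 / (\<integral>v. joint_density U1 U2 \<rho> w1 v \<partial>lborel)"

section \<open>The two approximations\<close>

text \<open>The integral over \<open>u\<close> is taken over the part of the fibre on which \<open>f\<close> is defined; for
  \<open>\<Omega> = UNIV\<close>, or when \<open>\<rho>\<close> vanishes off \<open>\<Omega>\<close>, it is the integral over the whole space.\<close>

definition F_gas ::
    "real^'d1^'d \<Rightarrow> real^'d2^'d \<Rightarrow> (real^'d \<Rightarrow> real) \<Rightarrow> (real^'d) set \<Rightarrow> (real^'d \<Rightarrow> real)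
      \<Rightarrow> real^'d \<Rightarrow> real" where
  "F_gas U1 U2 \<rho> \<Omega> f z =
     (let w1 = transpose U1 *v z in
      set_lebesgue_integral lborel {u. U1 *v w1 + U2 *v u \<in> \<Omega>}
        (\<lambda>u. f (U1 *v w1 + U2 *v u) * cond_density U1 U2 \<rho> w1 u))"

definition F_mc ::
    "real^'d1^'d \<Rightarrow> real^'d2^'d \<Rightarrow> (real^'d \<Rightarrow> real) \<Rightarrow> nat \<Rightarrow> (nat \<Rightarrow> real^'d2)
      \<Rightarrow> real^'d \<Rightarrow> real" where
  "F_mc U1 U2 f N u z =
     (let w1 = transpose U1 *v z in
      1 / real N * (\<Sum>i=1..N. f (U1 *v w1 + U2 *v u i)))"

text \<open>Given \<open>W\<close>, the \<open>u i\<close> (\<open>i \<in> I\<close>) are independent with density \<open>\<kappa> W\<close>: the conditional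
  probability of \<open>\<forall>i\<in>I. u i \<in> B i\<close> given \<open>W\<close> is the product of the \<open>\<kappa> W\<close>-probabilities of the
  \<open>B i\<close>, written out by integrating over the events \<open>W \<in> A\<close>. Only conditioning on \<open>W\<close> is
  involved: nothing is required about other random variables on the same space.\<close>

definition cond_iid_given ::
    "'w measure \<Rightarrow> ('w \<Rightarrow> real^'m) \<Rightarrow> nat set \<Rightarrow> (nat \<Rightarrow> 'w \<Rightarrow> real^'k)
      \<Rightarrow> (real^'m \<Rightarrow> real^'k \<Rightarrow> real) \<Rightarrow> bool" where
  "cond_iid_given M W I u \<kappa> \<longleftrightarrow>
     W \<in> borel_measurable M \<and> (\<forall>i\<in>I. u i \<in> borel_measurable M) \<and>
     (\<forall>A\<in>sets borel. \<forall>B. (\<forall>i\<in>I. B i \<in> sets borel) \<longrightarrow>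
        measure M {\<omega> \<in> space M. W \<omega> \<in> A \<and> (\<forall>i\<in>I. u i \<omega> \<in> B i)} =
        (\<integral>\<omega>. indicator A (W \<omega>) *
              (\<Prod>i\<in>I. set_lebesgue_integral lborel (B i) (\<kappa> (W \<omega>))) \<partial>M))"

end

theory Submission
  imports Defs
begin


text \<open>
  Write \<open>W\<close> for the first block of coordinates of \<open>Z\<close>, \<open>X\<close> for the second one, and
  \<open>h (w, v) = f (U1 *v w + U2 *v v)\<close>. Then \<open>f Z = h (W, X)\<close>, the Monte Carlo estimate is the
  mean of the \<open>h (W, u i)\<close>, and \<open>F_gas\<close> is \<open>G W\<close>, where \<open>G w\<close> is the mean of \<open>h (w, \<cdot>)\<close> under
  the conditional law of \<open>X\<close> given \<open>W = w\<close>. Put \<open>\<phi> (w, v) = h (w, v) - G w\<close>. The error of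
  the Monte Carlo estimate is the sum of
  \<^item> the sampling error, which is the mean of the \<open>\<phi> (W, u i)\<close>, and
  \<^item> the error of \<open>F_gas\<close>, which is \<open>- \<phi> (W, X)\<close>.

  Each \<open>(W, u i)\<close> has the law of \<open>(W, X)\<close>, so every \<open>\<phi> (W, u i)\<close> has the second moment \<open>\<sigma>\<^sup>2\<close> of
  the error of \<open>F_gas\<close>. Given \<open>W\<close> the samples are independent and \<open>\<phi> (W, \<cdot>)\<close> is centred, so
  the \<open>\<phi> (W, u i)\<close> are pairwise orthogonal and their mean has norm \<open>\<sigma> / sqrt N1\<close> in \<open>L\<^sup>2\<close>. The
  triangle inequality gives \<open>\<sigma> / sqrt N1 + \<sigma>\<close>. It is the triangle inequality, and not an
  addition of variances, because the joint law of the samples and \<open>X\<close> is unknown: only the joint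
  law of the samples and \<open>W\<close> is given.

  The argument is carried out for an abstract kernel in \<open>sample_mean_error\<close>. To apply it, the
  normalized joint density has to be a version of the conditional law of \<open>X\<close> given \<open>W\<close>
  (\<open>cond_law_of_complement\<close>). This is Fubini's theorem in the rotated coordinates, for which
  Lebesgue measure on the whole space must be the product of the Lebesgue measures on the two
  blocks (\<open>distr_lborel_linear_isometry\<close>).
\<close>

section \<open>Linear isometries preserve Lebesgue measure\<close>

lemma lborel_integral_reflect:
  fixes g :: "'b::euclidean_space \<Rightarrow> ennreal"
  assumes [measurable]: "g \<in> borel_measurable borel"
  shows "(\<integral>\<^sup>+x. g (c - x) \<partial>lborel) = (\<integral>\<^sup>+x. g x \<partial>lborel)"
proof -
  have "(lborel :: 'b measure) = distr lborel borel (\<lambda>x. c - x)"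
    using lborel_affine[of "-1" c] by (simp add: density_1)
  then have "(\<integral>\<^sup>+x. g x \<partial>lborel) = (\<integral>\<^sup>+x. g x \<partial>distr lborel borel (\<lambda>x. c - x))"
    by simp
  also have "\<dots> = (\<integral>\<^sup>+x. g (c - x) \<partial>lborel)"
    by (subst nn_integral_distr) auto
  finally show ?thesis ..
qed

text \<open>
  The classical proof that an invariant measure is unique up to a factor: the image of Lebesgue
  measure under \<open>T\<close> is translation invariant, and then Fubini's theorem, with translations and a
  reflection in the inner integrals, lets \<open>f\<close> and \<open>g\<close> trade places. Any \<open>g\<close> with known
  positive integrals then identifies the image measure.
\<close>
lemma lborel_integral_linear_image_swap:
  fixes T :: "'a::euclidean_space \<Rightarrow> 'b::euclidean_space"
  assumes T: "linear T" "surj T"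
    and [measurable]: "f \<in> borel_measurable borel" "g \<in> borel_measurable borel"
  shows "(\<integral>\<^sup>+x. f x \<partial>lborel) * (\<integral>\<^sup>+a. g (T a) \<partial>lborel) =
         (\<integral>\<^sup>+x. g x \<partial>lborel) * (\<integral>\<^sup>+a. f (T a) \<partial>(lborel :: 'a measure) :: ennreal)"
proof -
  have T_meas[measurable]: "T \<in> borel_measurable borel"
    using T(1) by (intro borel_measurable_continuous_onI linear_continuous_on linear_linear[THEN iffD2])
  have shift: "(\<integral>\<^sup>+a. k (T a - x) \<partial>lborel) = (\<integral>\<^sup>+a. k (T a) \<partial>lborel)"
    if [measurable]: "k \<in> borel_measurable borel" for k :: "'b \<Rightarrow> ennreal" and x
  proof -
    obtain s where s: "T s = x" using T(2) by (metis surjD)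
    have "(\<integral>\<^sup>+a. k (T a) \<partial>lborel) = (\<integral>\<^sup>+a. k (T a) \<partial>distr lborel borel ((+) (- s)))"
      by (simp add: lborel_distr_plus)
    also have "\<dots> = (\<integral>\<^sup>+a. k (T (- s + a)) \<partial>lborel)"
      by (subst nn_integral_distr) auto
    also have "\<dots> = (\<integral>\<^sup>+a. k (T a - x) \<partial>lborel)"
      using T(1) s by (simp add: linear_diff)
    finally show ?thesis ..
  qed
  \<comment> \<open>Shift \<open>T a\<close> by \<open>x\<close>, exchange the integrals, substitute \<open>T a - x\<close> for \<open>x\<close>, and undo the shift.\<close>
  have "(\<integral>\<^sup>+x. f x \<partial>lborel) * (\<integral>\<^sup>+a. g (T a) \<partial>lborel)
      = (\<integral>\<^sup>+x. f x * (\<integral>\<^sup>+a. g (T a - x) \<partial>lborel) \<partial>lborel)"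
    by (simp add: shift nn_integral_multc)
  also have "\<dots> = (\<integral>\<^sup>+x. (\<integral>\<^sup>+a. f x * g (T a - x) \<partial>lborel) \<partial>lborel)"
    by (simp add: nn_integral_cmult)
  also have "\<dots> = (\<integral>\<^sup>+a. (\<integral>\<^sup>+x. f x * g (T a - x) \<partial>lborel) \<partial>lborel)"
    by (rule lborel_pair.Fubini'[symmetric]) measurable
  also have "\<dots> = (\<integral>\<^sup>+a. (\<integral>\<^sup>+x. g x * f (T a - x) \<partial>lborel) \<partial>lborel)"
  proof (rule nn_integral_cong)
    fix a :: 'a
    show "(\<integral>\<^sup>+x. f x * g (T a - x) \<partial>lborel) = (\<integral>\<^sup>+x. g x * f (T a - x) \<partial>lborel)"
      using lborel_integral_reflect[of "\<lambda>x. f x * g (T a - x)" "T a"] by (simp add: mult.commute)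
  qed
  also have "\<dots> = (\<integral>\<^sup>+x. (\<integral>\<^sup>+a. g x * f (T a - x) \<partial>lborel) \<partial>lborel)"
    by (rule lborel_pair.Fubini') measurable
  also have "\<dots> = (\<integral>\<^sup>+x. g x * (\<integral>\<^sup>+a. f (T a - x) \<partial>lborel) \<partial>lborel)"
    by (simp add: nn_integral_cmult)
  also have "\<dots> = (\<integral>\<^sup>+x. g x \<partial>lborel) * (\<integral>\<^sup>+a. f (T a) \<partial>lborel)"
    by (simp add: shift nn_integral_multc)
  finally show ?thesis .
qed

text \<open>
  The unit ball calibrates the factor: an isometry pulls the unit ball back to the unit ball, and
  the volumes of the two balls agree because the dimensions do.
\<close>
lemma distr_lborel_linear_isometry:
  fixes T :: "'a::euclidean_space \<Rightarrow> 'b::euclidean_space"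
  assumes T: "linear T" "surj T" and iso: "\<And>x. norm (T x) = norm x"
  shows "distr lborel borel T = lborel"
proof (rule measure_eqI)
  have T_meas[measurable]: "T \<in> borel_measurable borel"
    using T(1) by (intro borel_measurable_continuous_onI linear_continuous_on linear_linear[THEN iffD2])
  have "inj T"
    unfolding linear_injective_0[OF T(1)] using iso by (metis norm_eq_zero)
  then have DIM: "DIM('a) = DIM('b)"
    using dim_image_eq[OF T(1), of UNIV] T(2) by (simp add: dim_UNIV)
  fix A assume "A \<in> sets (distr lborel borel T)"
  then have [measurable]: "A \<in> sets borel" by simp
  let ?B = "indicator (ball 0 1) :: 'b \<Rightarrow> ennreal"
  have "(\<integral>\<^sup>+a. ?B (T a) \<partial>lborel) = (\<integral>\<^sup>+a. indicator (ball 0 1) a \<partial>(lborel :: 'a measure))"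
    by (intro nn_integral_cong) (simp add: iso indicator_def)
  also have "\<dots> = unit_ball_vol DIM('b)"
    by (simp add: emeasure_ball DIM)
  finally have "emeasure lborel A * unit_ball_vol DIM('b)
      = unit_ball_vol DIM('b) * (\<integral>\<^sup>+a. indicator A (T a) \<partial>lborel)"
    using lborel_integral_linear_image_swap[OF T, of "indicator A" ?B]
    by (simp add: emeasure_ball borel_measurable_indicator)
  moreover have "(\<integral>\<^sup>+a. indicator A (T a) \<partial>lborel) = emeasure (distr lborel borel T) A"
    by (subst nn_integral_distr[symmetric, where M'=borel]) auto
  moreover have "ennreal (unit_ball_vol DIM('b)) \<noteq> 0"
    using unit_ball_vol_pos[of "real DIM('b)"] by (simp add: ennreal_eq_0_iff not_le)
  ultimately show "emeasure (distr lborel borel T) A = emeasure lborel A"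
    by (metis ennreal_mult_cancel_left mult.commute ennreal_neq_top)
qed simp

section \<open>Conditional laws given by a kernel\<close>

text \<open>
  \<open>K\<close> is a regular version of the conditional law of \<open>X\<close> given \<open>W\<close>. Testing with all
  nonnegative functions of the pair, not only with rectangles, is the form in which the law is used.
\<close>
definition has_cond_law ::
    "'w measure \<Rightarrow> 's measure \<Rightarrow> 't measure \<Rightarrow> ('w \<Rightarrow> 's) \<Rightarrow> ('w \<Rightarrow> 't) \<Rightarrow> ('s \<Rightarrow> 't measure) \<Rightarrow> bool"
  where "has_cond_law M S T W X K \<longleftrightarrow>
    (\<forall>g \<in> borel_measurable (S \<Otimes>\<^sub>M T).
       (\<integral>\<^sup>+\<omega>. g (W \<omega>, X \<omega>) \<partial>M) = (\<integral>\<^sup>+\<omega>. (\<integral>\<^sup>+a. g (W \<omega>, a) \<partial>K (W \<omega>)) \<partial>M))"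

text \<open>
  It suffices to test rectangles whose second side runs through a generator \<open>E\<close> of \<open>T\<close>. The
  generator is a parameter so that, for a pair of samples, the second side can itself be restricted
  to rectangles.
\<close>
lemma (in prob_space) has_cond_lawI:
  assumes W[measurable]: "W \<in> measurable M S" and X[measurable]: "X \<in> measurable M T"
    and K[measurable]: "K \<in> measurable S (subprob_algebra T)"
    and E: "Int_stable E" "E \<subseteq> Pow (space T)" "space T \<in> E" "sets T = sigma_sets (space T) E"
    and rect: "\<And>A B. A \<in> sets S \<Longrightarrow> B \<in> E \<Longrightarrow>
      emeasure M {\<omega> \<in> space M. W \<omega> \<in> A \<and> X \<omega> \<in> B} =
      (\<integral>\<^sup>+\<omega>. indicator A (W \<omega>) * emeasure (K (W \<omega>)) B \<partial>M)"
  shows "has_cond_law M S T W X K"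
  unfolding has_cond_law_def
proof
  fix g :: "_ \<Rightarrow> ennreal" assume g[measurable]: "g \<in> borel_measurable (S \<Otimes>\<^sub>M T)"
  \<comment> \<open>The law that the pair should have, as a measure; it agrees with the actual one on the rectangles.\<close>
  define Q where "Q = M \<bind> (\<lambda>\<omega>. distr (K (W \<omega>)) (S \<Otimes>\<^sub>M T) (\<lambda>a. (W \<omega>, a)))"
  have Q_kernel[measurable]:
    "(\<lambda>\<omega>. distr (K (W \<omega>)) (S \<Otimes>\<^sub>M T) (\<lambda>a. (W \<omega>, a))) \<in> measurable M (subprob_algebra (S \<Otimes>\<^sub>M T))"
    by (rule measurable_distr2[where M=T]) measurable
  have sets_K: "sets (K (W \<omega>)) = sets T" if "\<omega> \<in> space M" for \<omega>
    using measurable_space[OF W that] K by (rule sets_kernel[rotated])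
  have nn_Q: "(\<integral>\<^sup>+p. k p \<partial>Q) = (\<integral>\<^sup>+\<omega>. (\<integral>\<^sup>+a. k (W \<omega>, a) \<partial>K (W \<omega>)) \<partial>M)"
    if [measurable]: "k \<in> borel_measurable (S \<Otimes>\<^sub>M T)" for k :: "_ \<Rightarrow> ennreal"
    unfolding Q_def
  proof (subst nn_integral_bind[where B="S \<Otimes>\<^sub>M T"], goal_cases)
    case 3
    show ?case
    proof (intro nn_integral_cong)
      fix \<omega> assume \<omega>: "\<omega> \<in> space M"
      have [measurable]: "W \<omega> \<in> space S" using W \<omega> by (rule measurable_space)
      have [measurable_cong]: "sets (K (W \<omega>)) = sets T" using \<omega> by (rule sets_K)
      have [measurable]: "(\<lambda>a. (W \<omega>, a)) \<in> measurable (K (W \<omega>)) (S \<Otimes>\<^sub>M T)"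
        unfolding measurable_cong_sets[OF sets_K[OF \<omega>] refl] by (rule measurable_Pair1') fact
      show "(\<integral>\<^sup>+p. k p \<partial>distr (K (W \<omega>)) (S \<Otimes>\<^sub>M T) (\<lambda>a. (W \<omega>, a)))
          = (\<integral>\<^sup>+a. k (W \<omega>, a) \<partial>K (W \<omega>))"
        by (subst nn_integral_distr) auto
    qed
  qed simp_all
  let ?R = "{A \<times> B | A B. A \<in> sets S \<and> B \<in> E}"
  have E_sets: "B \<in> sets T" if "B \<in> E" for B
    using that E(4) by auto
  have sets_Q: "sets Q = sets (S \<Otimes>\<^sub>M T)"
    unfolding Q_def by (rule sets_bind) (auto simp: not_empty)
  have sigma: "sets (S \<Otimes>\<^sub>M T) = sigma_sets (space S \<times> space T) ?R"
  proof -
    have "sets (S \<Otimes>\<^sub>M T) = sets (sigma (space S \<times> space T) ?R)"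
      using E by (intro sets_pair_eq[where Ca="{space S}" and Cb="{space T}"])
        (auto simp: sets.sigma_sets_eq sets.space_closed)
    also have "\<dots> = sigma_sets (space S \<times> space T) ?R"
      using E(2) sets.sets_into_space[of _ S] by (intro sets_measure_of) blast
    finally show ?thesis .
  qed
  have "distr M (S \<Otimes>\<^sub>M T) (\<lambda>\<omega>. (W \<omega>, X \<omega>)) = Q"
  proof (rule measure_eqI_generator_eq[where E="?R" and \<Omega>="space S \<times> space T" and A="\<lambda>_. space S \<times> space T"])
    show "Int_stable ?R"
    proof (rule Int_stableI)
      fix C D assume "C \<in> ?R" "D \<in> ?R"
      then obtain A A' B B' where *: "C = A \<times> B" "D = A' \<times> B'"
        "A \<in> sets S" "A' \<in> sets S" "B \<in> E" "B' \<in> E"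
        by blast
      have "C \<inter> D = (A \<inter> A') \<times> (B \<inter> B')" "A \<inter> A' \<in> sets S" "B \<inter> B' \<in> E"
        using * E(1) by (auto simp: Int_stable_def)
      then show "C \<inter> D \<in> ?R" by blast
    qed
    show "?R \<subseteq> Pow (space S \<times> space T)"
      using E(2) sets.sets_into_space[of _ S] by blast
    show "range (\<lambda>_::nat. space S \<times> space T) \<subseteq> ?R" using E(3) by auto
    fix C assume "C \<in> ?R"
    then obtain A B where C: "C = A \<times> B" and A[measurable]: "A \<in> sets S" and B: "B \<in> E" by auto
    have [measurable]: "B \<in> sets T" using B by (rule E_sets)
    have "emeasure (distr M (S \<Otimes>\<^sub>M T) (\<lambda>\<omega>. (W \<omega>, X \<omega>))) C
        = emeasure M {\<omega> \<in> space M. W \<omega> \<in> A \<and> X \<omega> \<in> B}"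
      unfolding C by (subst emeasure_distr) (auto intro!: arg_cong[where f="emeasure M"])
    also have "\<dots> = (\<integral>\<^sup>+\<omega>. indicator A (W \<omega>) * emeasure (K (W \<omega>)) B \<partial>M)"
      using A B by (rule rect)
    also have "\<dots> = (\<integral>\<^sup>+\<omega>. (\<integral>\<^sup>+a. indicator C (W \<omega>, a) \<partial>K (W \<omega>)) \<partial>M)"
    proof (intro nn_integral_cong)
      fix \<omega> assume \<omega>: "\<omega> \<in> space M"
      have [measurable_cong]: "sets (K (W \<omega>)) = sets T" using \<omega> by (rule sets_K)
      show "indicator A (W \<omega>) * emeasure (K (W \<omega>)) B = (\<integral>\<^sup>+a. indicator C (W \<omega>, a) \<partial>K (W \<omega>))"
        using B E_sets sets_K[OF \<omega>] unfolding C
        by (simp add: indicator_times nn_integral_cmult_indicator)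
    qed
    also have "\<dots> = emeasure Q C"
      using nn_Q[of "indicator C"] by (simp add: C sets_Q)
    finally show "emeasure (distr M (S \<Otimes>\<^sub>M T) (\<lambda>\<omega>. (W \<omega>, X \<omega>))) C = emeasure Q C" .
  next
    show "emeasure (distr M (S \<Otimes>\<^sub>M T) (\<lambda>\<omega>. (W \<omega>, X \<omega>))) (space S \<times> space T) \<noteq> \<infinity>"
      by (subst emeasure_distr) (auto simp: space_pair_measure[symmetric] less_top[symmetric])
  qed (auto simp: sets_Q sigma)
  then have "(\<integral>\<^sup>+p. g p \<partial>Q) = (\<integral>\<^sup>+\<omega>. g (W \<omega>, X \<omega>) \<partial>M)"
    by (subst nn_integral_distr[symmetric, where M'="S \<Otimes>\<^sub>M T"]) auto
  with nn_Q[OF g] show "(\<integral>\<^sup>+\<omega>. g (W \<omega>, X \<omega>) \<partial>M) = (\<integral>\<^sup>+\<omega>. (\<integral>\<^sup>+a. g (W \<omega>, a) \<partial>K (W \<omega>)) \<partial>M)"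
    by simp
qed

text \<open>
  The kernel may lose mass on a null set of values of \<open>W\<close> (for a conditional density, where the
  marginal density vanishes or is infinite). Testing the law with the constant \<open>1\<close> shows that it
  has mass \<open>1\<close> on average, and it never has more.
\<close>
lemma (in prob_space) has_cond_law_imp_AE_prob_space:
  assumes W[measurable]: "W \<in> measurable M S" and K: "K \<in> measurable S (subprob_algebra T)"
    and law: "has_cond_law M S T W X K"
  shows "AE \<omega> in M. prob_space (K (W \<omega>))"
proof -
  let ?k = "\<lambda>\<omega>. emeasure (K (W \<omega>)) (space T)"
  have K_sub: "subprob_space (K (W \<omega>))" and K_space: "space (K (W \<omega>)) = space T" if "\<omega> \<in> space M" for \<omega>
    using K measurable_space[OF W that] by (auto intro: subprob_space_kernel dest: sets_kernel[THEN sets_eq_imp_space_eq])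
  have k_meas[measurable]: "?k \<in> borel_measurable M"
    by (rule measurable_compose[OF W measurable_emeasure_kernel[OF K sets.top]])
  have k_le: "?k \<omega> \<le> 1" if "\<omega> \<in> space M" for \<omega>
    using subprob_space.subprob_emeasure_le_1[OF K_sub[OF that]] .
  have "(\<integral>\<^sup>+\<omega>. 1 \<partial>M) = (\<integral>\<^sup>+\<omega>. (\<integral>\<^sup>+a. 1 \<partial>K (W \<omega>)) \<partial>M)"
    using law unfolding has_cond_law_def by (rule bspec) simp
  also have "\<dots> = (\<integral>\<^sup>+\<omega>. ?k \<omega> \<partial>M)"
    by (intro nn_integral_cong) (simp add: K_space)
  finally have k_int: "(\<integral>\<^sup>+\<omega>. ?k \<omega> \<partial>M) = 1" by (simp add: emeasure_space_1)
  have "(\<integral>\<^sup>+\<omega>. 1 - ?k \<omega> \<partial>M) = (\<integral>\<^sup>+\<omega>. 1 \<partial>M) - (\<integral>\<^sup>+\<omega>. ?k \<omega> \<partial>M)"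
    using k_le k_int by (intro nn_integral_diff) (auto intro: AE_I2)
  then have "(\<integral>\<^sup>+\<omega>. 1 - ?k \<omega> \<partial>M) = 0"
    by (simp add: k_int emeasure_space_1)
  then have "AE \<omega> in M. 1 - ?k \<omega> = 0"
    by (subst (asm) nn_integral_0_iff_AE) auto
  with AE_space show ?thesis
  proof eventually_elim
    case (elim \<omega>)
    have "?k \<omega> = 1" using elim(2) k_le[OF elim(1)] by (metis antisym diff_eq_0_iff_ennreal)
    then show ?case using K_space[OF elim(1)] by (intro prob_spaceI) simp
  qed
qed

section \<open>Second moments\<close>

text \<open>
  That the centred function has mean \<open>0\<close> is expressed by its positive and negative parts having
  the same integral, so that it can later be used inside nonnegative integrals.
\<close>
lemma (in prob_space) centring:
  fixes h :: "'a \<Rightarrow> real"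
  assumes [measurable]: "h \<in> borel_measurable M"
    and fin: "(\<integral>\<^sup>+x. ennreal ((h x)\<^sup>2) \<partial>M) < \<infinity>"
  defines "c \<equiv> \<integral>x. h x \<partial>M"
  shows "(\<integral>\<^sup>+x. ennreal (h x - c) \<partial>M) = (\<integral>\<^sup>+x. ennreal (c - h x) \<partial>M)"
    and "(\<integral>\<^sup>+x. ennreal ((h x - c)\<^sup>2) \<partial>M) \<le> (\<integral>\<^sup>+x. ennreal ((h x)\<^sup>2) \<partial>M)"
proof -
  have sq: "integrable M (\<lambda>x. (h x)\<^sup>2)"
    using fin by (intro integrableI_bounded) auto
  have int: "integrable M h"
    by (rule square_integrable_imp_integrable[OF _ sq]) simp
  have "(\<integral>x. h x - c \<partial>M) = 0"
    using int by (simp add: c_def prob_space)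
  moreover have intc: "integrable M (\<lambda>x. h x - c)"
    using int by simp
  ultimately have "enn2real (\<integral>\<^sup>+x. ennreal (h x - c) \<partial>M) = enn2real (\<integral>\<^sup>+x. ennreal (- (h x - c)) \<partial>M)"
    using real_lebesgue_integral_def[OF intc] by simp
  moreover have "(\<integral>\<^sup>+x. ennreal (h x - c) \<partial>M) < \<infinity>" "(\<integral>\<^sup>+x. ennreal (- (h x - c)) \<partial>M) < \<infinity>"
    using intc by (auto simp: real_integrable_def top.not_eq_extremum)
  ultimately have "(\<integral>\<^sup>+x. ennreal (h x - c) \<partial>M) = (\<integral>\<^sup>+x. ennreal (- (h x - c)) \<partial>M)"
    by (metis ennreal_enn2real infinity_ennreal_def)
  then show "(\<integral>\<^sup>+x. ennreal (h x - c) \<partial>M) = (\<integral>\<^sup>+x. ennreal (c - h x) \<partial>M)"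
    by simp
  have "(\<integral>x. (h x - c)\<^sup>2 \<partial>M) = (\<integral>x. (h x)\<^sup>2 \<partial>M) - c\<^sup>2"
    using variance_eq[OF int sq] by (simp add: c_def)
  also have "\<dots> \<le> (\<integral>x. (h x)\<^sup>2 \<partial>M)" by simp
  finally have "ennreal (\<integral>x. (h x - c)\<^sup>2 \<partial>M) \<le> ennreal (\<integral>x. (h x)\<^sup>2 \<partial>M)"
    by (rule ennreal_leI)
  moreover have "integrable M (\<lambda>x. (h x - c)\<^sup>2)"
    using int sq by (simp add: power2_diff)
  ultimately show "(\<integral>\<^sup>+x. ennreal ((h x - c)\<^sup>2) \<partial>M) \<le> (\<integral>\<^sup>+x. ennreal ((h x)\<^sup>2) \<partial>M)"
    using sq by (simp add: nn_integral_eq_integral)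
qed

text \<open>
  Conditional independence and centring make the two factors orthogonal. The conditional law is
  available for nonnegative functions only, so each factor is split into positive and negative
  part. As the two parts have the same conditional mean \<open>q\<close>, each of the four resulting products
  has expectation \<open>E q\<^sup>2\<close>, and they cancel.
\<close>
lemma cond_law_orthogonal:
  fixes \<phi> :: "'s \<times> 't \<Rightarrow> real"
  assumes law: "has_cond_law M S (T \<Otimes>\<^sub>M T) W (\<lambda>\<omega>. (X \<omega>, Y \<omega>)) (\<lambda>w. K w \<Otimes>\<^sub>M K w)"
    and W[measurable]: "W \<in> measurable M S" and K: "K \<in> measurable S (subprob_algebra T)"
    and [measurable]: "X \<in> measurable M T" "Y \<in> measurable M T"
    and \<phi>[measurable]: "\<phi> \<in> borel_measurable (S \<Otimes>\<^sub>M T)"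
    and centred: "AE \<omega> in M. (\<integral>\<^sup>+a. ennreal (\<phi> (W \<omega>, a)) \<partial>K (W \<omega>)) = (\<integral>\<^sup>+a. ennreal (- \<phi> (W \<omega>, a)) \<partial>K (W \<omega>))"
    and sqX: "integrable M (\<lambda>\<omega>. (\<phi> (W \<omega>, X \<omega>))\<^sup>2)" and sqY: "integrable M (\<lambda>\<omega>. (\<phi> (W \<omega>, Y \<omega>))\<^sup>2)"
  shows "integrable M (\<lambda>\<omega>. \<phi> (W \<omega>, X \<omega>) * \<phi> (W \<omega>, Y \<omega>))"
    and "(\<integral>\<omega>. \<phi> (W \<omega>, X \<omega>) * \<phi> (W \<omega>, Y \<omega>) \<partial>M) = 0"
proof -
  \<comment> \<open>The positive part of \<open>\<phi>\<close> for \<open>s = 1\<close>, the negative part for \<open>s = -1\<close>.\<close>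
  define part where "part s p = max 0 (s * \<phi> p)" for s p
  define q where "q s \<omega> = (\<integral>\<^sup>+a. ennreal (part s (W \<omega>, a)) \<partial>K (W \<omega>))" for s \<omega>
  define prod where "prod s t \<omega> = part s (W \<omega>, X \<omega>) * part t (W \<omega>, Y \<omega>)" for s t \<omega>
  have part_meas[measurable]: "part s \<in> borel_measurable (S \<Otimes>\<^sub>M T)" for s
    unfolding part_def by measurable
  have dominated: "\<bar>x * y\<bar> \<le> x\<^sup>2 + y\<^sup>2" for x y :: real
  proof -
    have "2 * (\<bar>x\<bar> * \<bar>y\<bar>) \<le> x\<^sup>2 + y\<^sup>2"
      using sum_squares_bound[of "\<bar>x\<bar>" "\<bar>y\<bar>"] by (simp add: mult.assoc)
    moreover have "0 \<le> \<bar>x\<bar> * \<bar>y\<bar>" by simp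
    ultimately show ?thesis unfolding abs_mult by linarith
  qed
  have int: "integrable M (prod s t)" if "\<bar>s\<bar> = 1" "\<bar>t\<bar> = 1" for s t
  proof (rule Bochner_Integration.integrable_bound[OF Bochner_Integration.integrable_add[OF sqX sqY]])
    show "prod s t \<in> borel_measurable M" unfolding prod_def by measurable
    have part_le: "\<bar>part r p\<bar> \<le> \<bar>\<phi> p\<bar>" if "\<bar>r\<bar> = 1" for r p
      using that by (auto simp: part_def abs_if split: if_splits)
    show "AE \<omega> in M. norm (prod s t \<omega>) \<le> norm ((\<phi> (W \<omega>, X \<omega>))\<^sup>2 + (\<phi> (W \<omega>, Y \<omega>))\<^sup>2)"
    proof (rule AE_I2)
      fix \<omega>
      have "\<bar>prod s t \<omega>\<bar> \<le> \<bar>\<phi> (W \<omega>, X \<omega>)\<bar> * \<bar>\<phi> (W \<omega>, Y \<omega>)\<bar>"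
        unfolding prod_def abs_mult using that by (intro mult_mono part_le) auto
      also have "\<dots> \<le> (\<phi> (W \<omega>, X \<omega>))\<^sup>2 + (\<phi> (W \<omega>, Y \<omega>))\<^sup>2"
        using dominated by (simp add: abs_mult)
      finally show "norm (prod s t \<omega>) \<le> norm ((\<phi> (W \<omega>, X \<omega>))\<^sup>2 + (\<phi> (W \<omega>, Y \<omega>))\<^sup>2)"
        by simp
    qed
  qed
  have nn: "(\<integral>\<^sup>+\<omega>. ennreal (prod s t \<omega>) \<partial>M) = (\<integral>\<^sup>+\<omega>. q s \<omega> * q t \<omega> \<partial>M)" for s t
  proof -
    have part_pos: "0 \<le> part r p" for r p by (simp add: part_def)
    let ?g = "\<lambda>(w, a, b). ennreal (part s (w, a)) * ennreal (part t (w, b))"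
    have "(\<integral>\<^sup>+\<omega>. ennreal (prod s t \<omega>) \<partial>M) = (\<integral>\<^sup>+\<omega>. ?g (W \<omega>, X \<omega>, Y \<omega>) \<partial>M)"
      by (simp add: prod_def ennreal_mult part_pos)
    also have "\<dots> = (\<integral>\<^sup>+\<omega>. (\<integral>\<^sup>+ab. ?g (W \<omega>, ab) \<partial>(K (W \<omega>) \<Otimes>\<^sub>M K (W \<omega>))) \<partial>M)"
      using law unfolding has_cond_law_def by (rule bspec) measurable
    also have "\<dots> = (\<integral>\<^sup>+\<omega>. q s \<omega> * q t \<omega> \<partial>M)"
    proof (rule nn_integral_cong)
      fix \<omega> assume \<omega>: "\<omega> \<in> space M"
      have W\<omega>: "W \<omega> \<in> space S" using W \<omega> by (rule measurable_space)
      have [measurable_cong]: "sets (K (W \<omega>)) = sets T" using K W\<omega> by (rule sets_kernel)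
      have "subprob_space (K (W \<omega>))" using K W\<omega> by (rule subprob_space_kernel)
      then interpret sigma_finite_measure "K (W \<omega>)" by (rule subprob_space_imp_sigma_finite)
      have [measurable]: "(\<lambda>a. part r (W \<omega>, a)) \<in> borel_measurable T" for r
        using measurable_compose[OF measurable_Pair1'[OF W\<omega>] part_meas] .
      have "(\<integral>\<^sup>+ab. ?g (W \<omega>, ab) \<partial>(K (W \<omega>) \<Otimes>\<^sub>M K (W \<omega>)))
          = (\<integral>\<^sup>+a. (\<integral>\<^sup>+b. ennreal (part s (W \<omega>, a)) * ennreal (part t (W \<omega>, b)) \<partial>K (W \<omega>)) \<partial>K (W \<omega>))"
        by (subst nn_integral_fst[symmetric]) (auto simp: case_prod_unfold)
      also have "\<dots> = q s \<omega> * q t \<omega>"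
        by (simp add: q_def nn_integral_cmult nn_integral_multc)
      finally show "(\<integral>\<^sup>+ab. ?g (W \<omega>, ab) \<partial>(K (W \<omega>) \<Otimes>\<^sub>M K (W \<omega>))) = q s \<omega> * q t \<omega>" .
    qed
    finally show ?thesis .
  qed
  have q_eq: "AE \<omega> in M. q 1 \<omega> = q (-1) \<omega>"
    using centred by eventually_elim (simp add: q_def part_def ennreal_max_0)
  have same: "(\<integral>\<omega>. prod s t \<omega> \<partial>M) = (\<integral>\<omega>. prod 1 1 \<omega> \<partial>M)" if "s = 1 \<or> s = -1" "t = 1 \<or> t = -1" for s t
  proof -
    have "(\<integral>\<^sup>+\<omega>. ennreal (prod s t \<omega>) \<partial>M) = (\<integral>\<^sup>+\<omega>. ennreal (prod 1 1 \<omega>) \<partial>M)"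
      unfolding nn using q_eq that by (intro nn_integral_cong_AE) (elim eventually_mono, auto)
    moreover have "prod s t \<in> borel_measurable M" for s t
      unfolding prod_def by measurable
    ultimately show ?thesis
      by (simp add: integral_eq_nn_integral prod_def part_def)
  qed
  have split: "\<phi> (W \<omega>, X \<omega>) * \<phi> (W \<omega>, Y \<omega>) =
      prod 1 1 \<omega> - prod 1 (-1) \<omega> - prod (-1) 1 \<omega> + prod (-1) (-1) \<omega>" for \<omega>
  proof -
    have parts: "\<phi> p = part 1 p - part (-1) p" for p by (simp add: part_def)
    show ?thesis unfolding prod_def parts by (simp only: algebra_simps)
  qed
  show "integrable M (\<lambda>\<omega>. \<phi> (W \<omega>, X \<omega>) * \<phi> (W \<omega>, Y \<omega>))"
    unfolding split by (intro Bochner_Integration.integrable_add Bochner_Integration.integrable_diff int) auto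
  show "(\<integral>\<omega>. \<phi> (W \<omega>, X \<omega>) * \<phi> (W \<omega>, Y \<omega>) \<partial>M) = 0"
    unfolding split
    by (simp add: int same[of 1 "-1"] same[of "-1" 1] same[of "-1" "-1"])
qed

lemma second_moment_orthogonal_sum:
  fixes A :: "'i \<Rightarrow> 'w \<Rightarrow> real"
  assumes int: "\<And>i j. i \<in> I \<Longrightarrow> j \<in> I \<Longrightarrow> integrable M (\<lambda>\<omega>. A i \<omega> * A j \<omega>)"
    and orth: "\<And>i j. i \<in> I \<Longrightarrow> j \<in> I \<Longrightarrow> i \<noteq> j \<Longrightarrow> (\<integral>\<omega>. A i \<omega> * A j \<omega> \<partial>M) = 0"
    and fin: "finite I"
  shows "integrable M (\<lambda>\<omega>. (\<Sum>i\<in>I. A i \<omega>)\<^sup>2)"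
    and "(\<integral>\<omega>. (\<Sum>i\<in>I. A i \<omega>)\<^sup>2 \<partial>M) = (\<Sum>i\<in>I. \<integral>\<omega>. (A i \<omega>)\<^sup>2 \<partial>M)"
proof -
  have sq: "(\<Sum>i\<in>I. A i \<omega>)\<^sup>2 = (\<Sum>i\<in>I. \<Sum>j\<in>I. A i \<omega> * A j \<omega>)" for \<omega>
    by (simp add: power2_eq_square sum_product)
  show "integrable M (\<lambda>\<omega>. (\<Sum>i\<in>I. A i \<omega>)\<^sup>2)"
    unfolding sq by (intro Bochner_Integration.integrable_sum int)
  have "(\<integral>\<omega>. (\<Sum>i\<in>I. A i \<omega>)\<^sup>2 \<partial>M) = (\<Sum>i\<in>I. \<Sum>j\<in>I. \<integral>\<omega>. A i \<omega> * A j \<omega> \<partial>M)"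
    unfolding sq by (simp add: int Bochner_Integration.integral_sum)
  also have "\<dots> = (\<Sum>i\<in>I. \<Sum>j\<in>I. if i = j then \<integral>\<omega>. A i \<omega> * A j \<omega> \<partial>M else 0)"
    by (intro sum.cong refl) (simp add: orth)
  also have "\<dots> = (\<Sum>i\<in>I. \<integral>\<omega>. (A i \<omega>)\<^sup>2 \<partial>M)"
    by (simp add: fin power2_eq_square)
  finally show "(\<integral>\<omega>. (\<Sum>i\<in>I. A i \<omega>)\<^sup>2 \<partial>M) = (\<Sum>i\<in>I. \<integral>\<omega>. (A i \<omega>)\<^sup>2 \<partial>M)" .
qed

text \<open>
  The triangle inequality in \<open>L\<^sup>2\<close> when the ratio \<open>s\<close> of the norms is known. Young's inequality
  \<open>2 x y \<le> x\<^sup>2 / s + s y\<^sup>2\<close> with this very \<open>s\<close> loses nothing, so the Cauchy-Schwarz inequality is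
  avoided.
\<close>
lemma minkowski_scaled_L2:
  fixes A B :: "'w \<Rightarrow> real"
  assumes [measurable]: "A \<in> borel_measurable M" "B \<in> borel_measurable M"
    and A2: "integrable M (\<lambda>\<omega>. (A \<omega>)\<^sup>2)" and B2: "integrable M (\<lambda>\<omega>. (B \<omega>)\<^sup>2)"
    and s: "s > 0" and scaled: "(\<integral>\<omega>. (A \<omega>)\<^sup>2 \<partial>M) = s\<^sup>2 * (\<integral>\<omega>. (B \<omega>)\<^sup>2 \<partial>M)"
  shows "integrable M (\<lambda>\<omega>. (A \<omega> + B \<omega>)\<^sup>2)"
    and "sqrt (\<integral>\<omega>. (A \<omega> + B \<omega>)\<^sup>2 \<partial>M) \<le> (1 + s) * sqrt (\<integral>\<omega>. (B \<omega>)\<^sup>2 \<partial>M)"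
proof -
  let ?bound = "\<lambda>\<omega>. (1 + 1 / s) * (A \<omega>)\<^sup>2 + (1 + s) * (B \<omega>)\<^sup>2"
  have young: "(x + y)\<^sup>2 \<le> (1 + 1 / s) * x\<^sup>2 + (1 + s) * y\<^sup>2" for x y :: real
  proof -
    have "0 \<le> (x - s * y)\<^sup>2 / s" using s by simp
    also have "(x - s * y)\<^sup>2 / s = (x\<^sup>2 - s * (2 * x * y) + s * (s * y\<^sup>2)) / s"
      by (simp add: power2_eq_square algebra_simps)
    also have "\<dots> = x\<^sup>2 / s - 2 * x * y + s * y\<^sup>2"
      using s by (simp add: add_divide_distrib diff_divide_distrib)
    finally show ?thesis by (simp add: power2_sum algebra_simps)
  qed
  have int: "integrable M ?bound" using A2 B2 by simp
  show sum: "integrable M (\<lambda>\<omega>. (A \<omega> + B \<omega>)\<^sup>2)"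
    by (rule Bochner_Integration.integrable_bound[OF int])
      (use young s in \<open>auto intro: AE_I2 order_trans[OF _ abs_ge_self]\<close>)
  have "(\<integral>\<omega>. (A \<omega> + B \<omega>)\<^sup>2 \<partial>M) \<le> (\<integral>\<omega>. ?bound \<omega> \<partial>M)"
    by (rule integral_mono[OF sum int]) (rule young)
  also have "\<dots> = (1 + 1 / s) * s\<^sup>2 * (\<integral>\<omega>. (B \<omega>)\<^sup>2 \<partial>M) + (1 + s) * (\<integral>\<omega>. (B \<omega>)\<^sup>2 \<partial>M)"
    using A2 B2 by (simp add: scaled)
  also have "\<dots> = (1 + s)\<^sup>2 * (\<integral>\<omega>. (B \<omega>)\<^sup>2 \<partial>M)"
    using s by (simp add: field_simps power2_eq_square)
  finally have "sqrt (\<integral>\<omega>. (A \<omega> + B \<omega>)\<^sup>2 \<partial>M) \<le> sqrt ((1 + s)\<^sup>2 * (\<integral>\<omega>. (B \<omega>)\<^sup>2 \<partial>M))"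
    by (rule real_sqrt_le_mono)
  then show "sqrt (\<integral>\<omega>. (A \<omega> + B \<omega>)\<^sup>2 \<partial>M) \<le> (1 + s) * sqrt (\<integral>\<omega>. (B \<omega>)\<^sup>2 \<partial>M)"
    using s by (simp add: real_sqrt_mult)
qed

section \<open>The mean squared error of a conditional sample mean\<close>

text \<open>
  The integrand varies with \<open>w\<close>; pushing \<open>K w\<close> forward to the fibre over \<open>w\<close> turns this into the
  integral of the fixed function \<open>h\<close>.
\<close>
lemma kernel_integral_measurable:
  fixes h :: "'s \<times> 't \<Rightarrow> real"
  assumes K[measurable]: "K \<in> measurable S (subprob_algebra T)"
    and h[measurable]: "h \<in> borel_measurable (S \<Otimes>\<^sub>M T)"
  shows "(\<lambda>w. \<integral>a. h (w, a) \<partial>K w) \<in> borel_measurable S"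
proof -
  have "(\<lambda>w. distr (K w) (S \<Otimes>\<^sub>M T) (\<lambda>a. (w, a))) \<in> measurable S (subprob_algebra (S \<Otimes>\<^sub>M T))"
    by (rule measurable_distr2[where M=T]) measurable
  from measurable_compose[OF this integral_measurable_subprob_algebra[OF h]]
  have "(\<lambda>w. \<integral>p. h p \<partial>distr (K w) (S \<Otimes>\<^sub>M T) (\<lambda>a. (w, a))) \<in> borel_measurable S" .
  moreover have "(\<integral>p. h p \<partial>distr (K w) (S \<Otimes>\<^sub>M T) (\<lambda>a. (w, a))) = (\<integral>a. h (w, a) \<partial>K w)"
    if w: "w \<in> space S" for w
  proof (rule integral_distr)
    show "(\<lambda>a. (w, a)) \<in> measurable (K w) (S \<Otimes>\<^sub>M T)"
      unfolding measurable_cong_sets[OF sets_kernel[OF K w] refl] using w by (rule measurable_Pair1')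
  qed simp
  ultimately show ?thesis
    by (simp cong: measurable_cong)
qed

text \<open>
  The error bound for an abstract kernel: \<open>h (W, X)\<close> is estimated from draws \<open>Y i\<close> that follow
  the conditional law of \<open>X\<close> given \<open>W\<close>. The variance of their mean needs conditional
  independence of pairs only.
\<close>
lemma (in prob_space) sample_mean_error:
  fixes h :: "'s \<times> 't \<Rightarrow> real" and Y :: "'i \<Rightarrow> 'a \<Rightarrow> 't"
  assumes W[measurable]: "W \<in> measurable M S" and X[measurable]: "X \<in> measurable M T"
    and Y[measurable]: "\<And>i. i \<in> I \<Longrightarrow> Y i \<in> measurable M T"
    and K[measurable]: "K \<in> measurable S (subprob_algebra T)"
    and h[measurable]: "h \<in> borel_measurable (S \<Otimes>\<^sub>M T)"
    and I: "finite I" "I \<noteq> {}"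
    and lawX: "has_cond_law M S T W X K"
    and lawY: "\<And>i. i \<in> I \<Longrightarrow> has_cond_law M S T W (Y i) K"
    and lawYY: "\<And>i j. i \<in> I \<Longrightarrow> j \<in> I \<Longrightarrow> i \<noteq> j \<Longrightarrow>
      has_cond_law M S (T \<Otimes>\<^sub>M T) W (\<lambda>\<omega>. (Y i \<omega>, Y j \<omega>)) (\<lambda>w. K w \<Otimes>\<^sub>M K w)"
    and sq: "integrable M (\<lambda>\<omega>. (h (W \<omega>, X \<omega>))\<^sup>2)"
  defines "G \<equiv> \<lambda>w. \<integral>a. h (w, a) \<partial>K w"
  shows "integrable M (\<lambda>\<omega>. ((\<Sum>i\<in>I. h (W \<omega>, Y i \<omega>)) / card I - h (W \<omega>, X \<omega>))\<^sup>2)" (is ?mc_int)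
    and "integrable M (\<lambda>\<omega>. (G (W \<omega>) - h (W \<omega>, X \<omega>))\<^sup>2)" (is ?gas_int)
    and "sqrt (\<integral>\<omega>. ((\<Sum>i\<in>I. h (W \<omega>, Y i \<omega>)) / card I - h (W \<omega>, X \<omega>))\<^sup>2 \<partial>M)
      \<le> (1 + 1 / sqrt (card I)) * sqrt (\<integral>\<omega>. (G (W \<omega>) - h (W \<omega>, X \<omega>))\<^sup>2 \<partial>M)" (is ?bound)
proof -
  note K_prob = has_cond_law_imp_AE_prob_space[OF W K lawX]
  define \<phi> where "\<phi> p = h p - G (fst p)" for p
  have [measurable]: "G \<in> borel_measurable S"
    unfolding G_def by (rule kernel_integral_measurable[OF K h])
  have \<phi>[measurable]: "\<phi> \<in> borel_measurable (S \<Otimes>\<^sub>M T)"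
    unfolding \<phi>_def by measurable
  have law_sq: "(\<integral>\<^sup>+\<omega>. ennreal ((k (W \<omega>, Z \<omega>))\<^sup>2) \<partial>M)
      = (\<integral>\<^sup>+\<omega>. (\<integral>\<^sup>+a. ennreal ((k (W \<omega>, a))\<^sup>2) \<partial>K (W \<omega>)) \<partial>M)"
    if "has_cond_law M S T W Z K" and [measurable]: "k \<in> borel_measurable (S \<Otimes>\<^sub>M T)"
    for Z and k :: "'s \<times> 't \<Rightarrow> real"
  proof -
    have "(\<lambda>p. ennreal ((k p)\<^sup>2)) \<in> borel_measurable (S \<Otimes>\<^sub>M T)" by measurable
    with that(1) show ?thesis unfolding has_cond_law_def by (rule bspec)
  qed
  \<comment> \<open>For almost every value of \<open>W\<close> the fibre of \<open>h\<close> is square-integrable, so it can be centred.\<close>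
  have h_fin: "(\<integral>\<^sup>+\<omega>. (\<integral>\<^sup>+a. ennreal ((h (W \<omega>, a))\<^sup>2) \<partial>K (W \<omega>)) \<partial>M) < \<infinity>"
    using sq unfolding law_sq[OF lawX h, symmetric] by (simp add: nn_integral_eq_integral)
  have fibre_meas: "(\<lambda>w. \<integral>\<^sup>+a. ennreal ((h (w, a))\<^sup>2) \<partial>K w) \<in> borel_measurable S"
    by (rule nn_integral_measurable_subprob_algebra2[OF _ K]) measurable
  have "AE \<omega> in M. (\<integral>\<^sup>+a. ennreal ((h (W \<omega>, a))\<^sup>2) \<partial>K (W \<omega>)) \<noteq> \<infinity>"
    using measurable_compose[OF W fibre_meas] h_fin by (intro nn_integral_PInf_AE) auto
  with K_prob AE_space have fibre: "AE \<omega> in M.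
      (\<integral>\<^sup>+a. ennreal (\<phi> (W \<omega>, a)) \<partial>K (W \<omega>)) = (\<integral>\<^sup>+a. ennreal (- \<phi> (W \<omega>, a)) \<partial>K (W \<omega>)) \<and>
      (\<integral>\<^sup>+a. ennreal ((\<phi> (W \<omega>, a))\<^sup>2) \<partial>K (W \<omega>)) \<le> (\<integral>\<^sup>+a. ennreal ((h (W \<omega>, a))\<^sup>2) \<partial>K (W \<omega>))"
  proof eventually_elim
    case (elim \<omega>)
    then interpret K: prob_space "K (W \<omega>)" by simp
    have W\<omega>: "W \<omega> \<in> space S" using W elim(2) by (rule measurable_space)
    have "(\<lambda>a. h (W \<omega>, a)) \<in> borel_measurable (K (W \<omega>))"
      unfolding measurable_cong_sets[OF sets_kernel[OF K W\<omega>] refl]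
      using measurable_compose[OF measurable_Pair1'[OF W\<omega>] h] .
    from K.centring[OF this] elim(3) show ?case
      by (simp add: \<phi>_def G_def top.not_eq_extremum)
  qed
  have \<phi>_fin: "(\<integral>\<^sup>+\<omega>. (\<integral>\<^sup>+a. ennreal ((\<phi> (W \<omega>, a))\<^sup>2) \<partial>K (W \<omega>)) \<partial>M) < \<infinity>"
    by (rule le_less_trans[OF nn_integral_mono_AE h_fin]) (use fibre in eventually_elim, simp)
  \<comment> \<open>Everything with the conditional law \<open>K\<close> gives \<open>\<phi>\<close> the same second moment, the draws and \<open>X\<close> alike.\<close>
  have \<phi>_int: "integrable M (\<lambda>\<omega>. (\<phi> (W \<omega>, Z \<omega>))\<^sup>2)"
    and \<phi>_eq: "(\<integral>\<omega>. (\<phi> (W \<omega>, Z \<omega>))\<^sup>2 \<partial>M) = (\<integral>\<omega>. (\<phi> (W \<omega>, X \<omega>))\<^sup>2 \<partial>M)"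
    if "has_cond_law M S T W Z K" and [measurable]: "Z \<in> measurable M T" for Z
  proof -
    show "integrable M (\<lambda>\<omega>. (\<phi> (W \<omega>, Z \<omega>))\<^sup>2)"
      using \<phi>_fin law_sq[OF that(1) \<phi>] by (intro integrableI_bounded) auto
    show "(\<integral>\<omega>. (\<phi> (W \<omega>, Z \<omega>))\<^sup>2 \<partial>M) = (\<integral>\<omega>. (\<phi> (W \<omega>, X \<omega>))\<^sup>2 \<partial>M)"
      using law_sq[OF that(1) \<phi>] law_sq[OF lawX \<phi>] by (simp add: integral_eq_nn_integral)
  qed
  have centred: "AE \<omega> in M. (\<integral>\<^sup>+a. ennreal (\<phi> (W \<omega>, a)) \<partial>K (W \<omega>)) = (\<integral>\<^sup>+a. ennreal (- \<phi> (W \<omega>, a)) \<partial>K (W \<omega>))"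
    using fibre by eventually_elim simp
  have products: "integrable M (\<lambda>\<omega>. \<phi> (W \<omega>, Y i \<omega>) * \<phi> (W \<omega>, Y j \<omega>))"
    "i \<noteq> j \<Longrightarrow> (\<integral>\<omega>. \<phi> (W \<omega>, Y i \<omega>) * \<phi> (W \<omega>, Y j \<omega>) \<partial>M) = 0" if "i \<in> I" "j \<in> I" for i j
  proof -
    note orth = cond_law_orthogonal[OF lawYY[OF that] W K Y[OF that(1)] Y[OF that(2)] \<phi> centred
        \<phi>_int[OF lawY Y] \<phi>_int[OF lawY Y], OF _ that(1) that(1) that(2) that(2)]
    show "integrable M (\<lambda>\<omega>. \<phi> (W \<omega>, Y i \<omega>) * \<phi> (W \<omega>, Y j \<omega>))"
      using orth(1) \<phi>_int[OF lawY Y, OF that(1) that(1)] by (cases "i = j") (simp_all add: power2_eq_square)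
    show "(\<integral>\<omega>. \<phi> (W \<omega>, Y i \<omega>) * \<phi> (W \<omega>, Y j \<omega>) \<partial>M) = 0" if "i \<noteq> j"
      using orth(2) that by simp
  qed
  \<comment> \<open>The sampling error and the error of the conditional mean; the norm of \<open>?A\<close> is \<open>1 / sqrt (card I)\<close>
    times that of \<open>?B\<close>.\<close>
  let ?A = "\<lambda>\<omega>. (\<Sum>i\<in>I. \<phi> (W \<omega>, Y i \<omega>)) / card I" and ?B = "\<lambda>\<omega>. - \<phi> (W \<omega>, X \<omega>)"
  have card: "real (card I) > 0" using I by (simp add: card_gt_0_iff)
  have A_int: "integrable M (\<lambda>\<omega>. (?A \<omega>)\<^sup>2)"
    using second_moment_orthogonal_sum(1)[OF products(1,2) I(1)] by (simp add: power_divide)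
  have "(\<integral>\<omega>. (\<Sum>i\<in>I. \<phi> (W \<omega>, Y i \<omega>))\<^sup>2 \<partial>M) = (\<Sum>i\<in>I. \<integral>\<omega>. (\<phi> (W \<omega>, Y i \<omega>))\<^sup>2 \<partial>M)"
    by (rule second_moment_orthogonal_sum(2)[OF products(1,2) I(1)])
  also have "\<dots> = card I * (\<integral>\<omega>. (\<phi> (W \<omega>, X \<omega>))\<^sup>2 \<partial>M)"
    by (simp add: \<phi>_eq[OF lawY Y])
  finally have "(\<integral>\<omega>. (?A \<omega>)\<^sup>2 \<partial>M) = (1 / sqrt (card I))\<^sup>2 * (\<integral>\<omega>. (?B \<omega>)\<^sup>2 \<partial>M)"
    using card by (simp add: power_divide field_simps power2_eq_square)
  note mink = minkowski_scaled_L2[where A="?A" and B="?B", OF _ _ A_int _ _ this]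
  have mink_int: "integrable M (\<lambda>\<omega>. (?A \<omega> + ?B \<omega>)\<^sup>2)"
    by (rule mink(1)) (use card \<phi>_int[OF lawX X] in simp_all)
  have mink_le: "sqrt (\<integral>\<omega>. (?A \<omega> + ?B \<omega>)\<^sup>2 \<partial>M) \<le> (1 + 1 / sqrt (card I)) * sqrt (\<integral>\<omega>. (?B \<omega>)\<^sup>2 \<partial>M)"
    by (rule mink(2)) (use card \<phi>_int[OF lawX X] in simp_all)
  have AB: "?A \<omega> + ?B \<omega> = (\<Sum>i\<in>I. h (W \<omega>, Y i \<omega>)) / card I - h (W \<omega>, X \<omega>)" for \<omega>
    using card by (simp add: \<phi>_def sum_subtractf diff_divide_distrib)
  have B: "?B \<omega> = G (W \<omega>) - h (W \<omega>, X \<omega>)" for \<omega>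
    by (simp add: \<phi>_def)
  show ?mc_int using mink_int unfolding AB .
  show ?gas_int using \<phi>_int[OF lawX X] unfolding B[symmetric] by simp
  show ?bound using mink_le unfolding AB unfolding B .
qed

section \<open>Orthogonal coordinates\<close>

text \<open>
  The two matrix equations, read off block by block: \<open>(w, v) \<mapsto> U1 *v w + U2 *v v\<close> is a
  bijection whose inverse is given by the two transposes.
\<close>
lemma orthogonal_blocks_coordinates:
  fixes U1 :: "real^'d1^'d" and U2 :: "real^'d2^'d"
  assumes "orthogonal_blocks U1 U2"
  shows "transpose U1 *v (U1 *v w + U2 *v v) = w"
    and "transpose U2 *v (U1 *v w + U2 *v v) = v"
    and "U1 *v (transpose U1 *v z) + U2 *v (transpose U2 *v z) = z"
proof -
  \<comment> \<open>The block matrix acts on vectors indexed by the disjoint union of the two column types.\<close>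
  define join :: "real^'d1 \<Rightarrow> real^'d2 \<Rightarrow> real^('d1 + 'd2)"
    where "join w v = (\<chi> k. case k of Inl a \<Rightarrow> w $ a | Inr b \<Rightarrow> v $ b)" for w v
  have B: "block_cols U1 U2 *v join w v = U1 *v w + U2 *v v" for w v
    by (simp add: vec_eq_iff matrix_vector_mult_def block_cols_def join_def
        UNIV_Plus_UNIV[symmetric] sum.Plus del: UNIV_Plus_UNIV)
  have Bt: "transpose (block_cols U1 U2) *v z = join (transpose U1 *v z) (transpose U2 *v z)" for z
    by (simp add: vec_eq_iff matrix_vector_mult_def block_cols_def join_def transpose_def
        split: sum.split)
  have inj: "w = w' \<and> v = v'" if "join w v = join w' v'" for w w' v v'
  proof -
    have "join w v $ k = join w' v' $ k" for k using that by simp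
    from this[of "Inl _"] this[of "Inr _"] show ?thesis by (simp add: join_def vec_eq_iff)
  qed
  have "transpose (block_cols U1 U2) *v (block_cols U1 U2 *v join w v) = join w v"
    using assms by (simp add: orthogonal_blocks_def matrix_vector_mul_assoc del: transpose_matrix_vector)
  then have "join (transpose U1 *v (U1 *v w + U2 *v v)) (transpose U2 *v (U1 *v w + U2 *v v)) = join w v"
    by (simp add: B Bt del: transpose_matrix_vector)
  then show "transpose U1 *v (U1 *v w + U2 *v v) = w" "transpose U2 *v (U1 *v w + U2 *v v) = v"
    by (auto dest: inj)
  have "block_cols U1 U2 *v (transpose (block_cols U1 U2) *v z) = z"
    using assms by (simp add: orthogonal_blocks_def matrix_vector_mul_assoc del: transpose_matrix_vector)
  then show "U1 *v (transpose U1 *v z) + U2 *v (transpose U2 *v z) = z"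
    by (simp add: B Bt del: transpose_matrix_vector)
qed

lemma matrix_vector_mult_borel_measurable [measurable]:
  fixes A :: "real^'m^'n"
  shows "(\<lambda>x. A *v x) \<in> borel_measurable borel"
  by (intro borel_measurable_continuous_onI linear_continuous_on linear_linear[THEN iffD2] matrix_vector_mul_linear)

text \<open>
  Fubini's theorem in rotated coordinates. By orthogonality the change of coordinates preserves the
  norm for the product of the two blocks, whose Lebesgue measure is the product measure.
\<close>
lemma lborel_integral_orthogonal_blocks:
  fixes U1 :: "real^'d1^'d" and U2 :: "real^'d2^'d"
  assumes U: "orthogonal_blocks U1 U2" and [measurable]: "f \<in> borel_measurable borel"
  shows "(\<integral>\<^sup>+x. f x \<partial>lborel) = (\<integral>\<^sup>+w. (\<integral>\<^sup>+v. f (U1 *v w + U2 *v v) \<partial>lborel) \<partial>lborel)"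
proof -
  let ?L = "\<lambda>p. U1 *v fst p + U2 *v snd p"
  note coords = orthogonal_blocks_coordinates[OF U]
  have "norm (?L p) = norm p" for p
  proof -
    have "?L p \<bullet> ?L p = fst p \<bullet> (transpose U1 *v ?L p) + snd p \<bullet> (transpose U2 *v ?L p)"
      by (simp only: inner_add_left dot_lmul_matrix[symmetric] transpose_matrix_vector[symmetric] transpose_transpose)
    also have "\<dots> = p \<bullet> p" by (simp only: coords inner_prod_def)
    finally show ?thesis by (simp add: norm_eq_sqrt_inner)
  qed
  moreover have "linear ?L"
    by (intro linearI) (simp_all add: matrix_vector_right_distrib scaleR_matrix_vector_assoc
        matrix_scaleR_vector_ac scaleR_right_distrib)
  moreover have "surj ?L"
    by (rule surjI[of _ "\<lambda>z. (transpose U1 *v z, transpose U2 *v z)"]) (simp add: coords del: transpose_matrix_vector)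
  ultimately have "distr lborel borel ?L = lborel"
    by (intro distr_lborel_linear_isometry)
  then have "(\<integral>\<^sup>+x. f x \<partial>lborel) = (\<integral>\<^sup>+x. f x \<partial>distr lborel borel ?L)" by simp
  also have "\<dots> = (\<integral>\<^sup>+p. f (?L p) \<partial>lborel)"
    by (rule nn_integral_distr) (simp_all add: borel_prod[symmetric])
  also have "\<dots> = (\<integral>\<^sup>+p. f (?L p) \<partial>(lborel \<Otimes>\<^sub>M lborel))" by (simp add: lborel_prod)
  also have "\<dots> = (\<integral>\<^sup>+w. (\<integral>\<^sup>+v. f (U1 *v w + U2 *v v) \<partial>lborel) \<partial>lborel)"
    by (subst lborel.nn_integral_fst[symmetric]) auto
  finally show ?thesis .
qed

section \<open>The conditional density as a kernel\<close>

text \<open>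
  Total mass is at most \<open>1\<close>, not always equal to it: \<open>\<kappa>\<close> vanishes identically if \<open>r\<close> has
  integral \<open>0\<close> or is not integrable, by the conventions for division and for the integral. The last
  identity still holds when the integral of \<open>r\<close> is \<open>0\<close>, because then \<open>r\<close> vanishes almost
  everywhere.
\<close>
lemma normalized_density:
  fixes r :: "'v \<Rightarrow> real"
  assumes r[measurable]: "r \<in> borel_measurable N" and r_nonneg: "\<And>v. 0 \<le> r v"
  defines "\<kappa> \<equiv> \<lambda>v. r v / (\<integral>v. r v \<partial>N)"
  shows normalized_density_subprob: "space N \<noteq> {} \<Longrightarrow> subprob_space (density N (\<lambda>v. ennreal (\<kappa> v)))"
    and normalized_density_measure:
      "B \<in> sets N \<Longrightarrow> set_lebesgue_integral N B \<kappa> = measure (density N (\<lambda>v. ennreal (\<kappa> v))) B"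
    and normalized_density_mult:
      "B \<in> sets N \<Longrightarrow> (\<integral>\<^sup>+v. ennreal (r v) \<partial>N) < \<infinity> \<Longrightarrow>
        (\<integral>\<^sup>+v. ennreal (r v) \<partial>N) * emeasure (density N (\<lambda>v. ennreal (\<kappa> v))) B = (\<integral>\<^sup>+v. ennreal (r v) * indicator B v \<partial>N)"
proof -
  have m_nonneg: "0 \<le> (\<integral>v. r v \<partial>N)" using r_nonneg by simp
  have nonneg: "0 \<le> \<kappa> v" for v using r_nonneg m_nonneg by (simp add: \<kappa>_def)
  have [measurable]: "\<kappa> \<in> borel_measurable N" unfolding \<kappa>_def by measurable
  have int: "integrable N \<kappa>"
    unfolding \<kappa>_def by (cases "integrable N r") (simp_all add: not_integrable_integral_eq)
  have "(\<integral>v. \<kappa> v \<partial>N) \<le> 1" by (simp add: \<kappa>_def)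
  then have le1: "(\<integral>\<^sup>+v. ennreal (\<kappa> v) \<partial>N) \<le> 1"
    using int nonneg by (simp add: nn_integral_eq_integral)
  show "subprob_space (density N (\<lambda>v. ennreal (\<kappa> v)))" if "space N \<noteq> {}"
  proof
    show "emeasure (density N (\<lambda>v. ennreal (\<kappa> v))) (space (density N (\<lambda>v. ennreal (\<kappa> v)))) \<le> 1"
      using le1 by (simp add: emeasure_density cong: nn_integral_cong)
  qed (use that in simp)
  show "set_lebesgue_integral N B \<kappa> = measure (density N (\<lambda>v. ennreal (\<kappa> v))) B" if [measurable]: "B \<in> sets N"
  proof -
    have "emeasure (density N (\<lambda>v. ennreal (\<kappa> v))) B = (\<integral>\<^sup>+v. ennreal (indicator B v * \<kappa> v) \<partial>N)"
      by (simp add: emeasure_density) (intro nn_integral_cong, simp add: indicator_def)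
    then show ?thesis
      using nonneg by (simp add: measure_def set_lebesgue_integral_def integral_eq_nn_integral)
  qed
  show "(\<integral>\<^sup>+v. ennreal (r v) \<partial>N) * emeasure (density N (\<lambda>v. ennreal (\<kappa> v))) B = (\<integral>\<^sup>+v. ennreal (r v) * indicator B v \<partial>N)"
    if [measurable]: "B \<in> sets N" and fin: "(\<integral>\<^sup>+v. ennreal (r v) \<partial>N) < \<infinity>"
  proof -
    have r_int: "integrable N r" using r_nonneg fin by (intro integrableI_bounded) auto
    then have m: "(\<integral>\<^sup>+v. ennreal (r v) \<partial>N) = ennreal (\<integral>v. r v \<partial>N)"
      using r_nonneg by (simp add: nn_integral_eq_integral)
    have r_eq: "AE v in N. r v = (\<integral>v. r v \<partial>N) * \<kappa> v"
    proof (cases "(\<integral>v. r v \<partial>N) = 0")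
      case True
      then show ?thesis
        using integral_nonneg_eq_0_iff_AE[OF r_int] r_nonneg by (auto elim: eventually_mono)
    qed (simp add: \<kappa>_def)
    have "(\<integral>\<^sup>+v. ennreal (r v) * indicator B v \<partial>N)
        = (\<integral>\<^sup>+v. ennreal (\<integral>v. r v \<partial>N) * (ennreal (\<kappa> v) * indicator B v) \<partial>N)"
    proof (intro nn_integral_cong_AE)
      show "AE v in N. ennreal (r v) * indicator B v = ennreal (\<integral>v. r v \<partial>N) * (ennreal (\<kappa> v) * indicator B v)"
        using r_eq
      proof eventually_elim
        case (elim v)
        show ?case by (subst elim) (simp add: ennreal_mult m_nonneg nonneg mult.assoc)
      qed
    qed
    then show ?thesis by (simp add: m emeasure_density nn_integral_cmult)
  qed
qed

definition cond_kernel ::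
    "real^'d1^'d \<Rightarrow> real^'d2^'d \<Rightarrow> (real^'d \<Rightarrow> real) \<Rightarrow> real^'d1 \<Rightarrow> (real^'d2) measure" where
  "cond_kernel U1 U2 \<rho> w = density lborel (\<lambda>v. ennreal (cond_density U1 U2 \<rho> w v))"

context
  fixes U1 :: "real^'d1^'d" and U2 :: "real^'d2^'d" and \<rho> :: "real^'d \<Rightarrow> real"
  assumes \<rho>[measurable]: "\<rho> \<in> borel_measurable borel" and \<rho>_nonneg: "\<And>x. 0 \<le> \<rho> x"
begin

lemma joint_density_measurable: "joint_density U1 U2 \<rho> w \<in> borel_measurable borel"
  unfolding joint_density_def by measurable

lemma joint_density_nonneg: "0 \<le> joint_density U1 U2 \<rho> w v"
  by (simp add: joint_density_def \<rho>_nonneg)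

lemma cond_density_fun:
  "cond_density U1 U2 \<rho> w = (\<lambda>v. joint_density U1 U2 \<rho> w v / (\<integral>v. joint_density U1 U2 \<rho> w v \<partial>lborel))"
  by (simp add: fun_eq_iff cond_density_def)

lemma cond_density_nonneg: "0 \<le> cond_density U1 U2 \<rho> w v"
  by (simp add: cond_density_def joint_density_nonneg)

lemma cond_kernel_subprob_space: "subprob_space (cond_kernel U1 U2 \<rho> w)"
  unfolding cond_kernel_def cond_density_fun
  by (rule normalized_density_subprob) (simp_all add: joint_density_measurable joint_density_nonneg)

lemma set_integral_cond_density:
  "B \<in> sets borel \<Longrightarrow>
    set_lebesgue_integral lborel B (cond_density U1 U2 \<rho> w) = measure (cond_kernel U1 U2 \<rho> w) B"
  unfolding cond_kernel_def cond_density_fun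
  by (rule normalized_density_measure) (simp_all add: joint_density_measurable joint_density_nonneg)

lemma marginal_times_cond_kernel:
  "B \<in> sets borel \<Longrightarrow> (\<integral>\<^sup>+v. ennreal (joint_density U1 U2 \<rho> w v) \<partial>lborel) < \<infinity> \<Longrightarrow>
    (\<integral>\<^sup>+v. ennreal (joint_density U1 U2 \<rho> w v) \<partial>lborel) * emeasure (cond_kernel U1 U2 \<rho> w) B
    = (\<integral>\<^sup>+v. ennreal (joint_density U1 U2 \<rho> w v) * indicator B v \<partial>lborel)"
  unfolding cond_kernel_def cond_density_fun
  by (rule normalized_density_mult) (simp_all add: joint_density_measurable joint_density_nonneg)

lemma cond_density_measurable[measurable]:
  "(\<lambda>(w, v). cond_density U1 U2 \<rho> w v) \<in> borel_measurable (borel \<Otimes>\<^sub>M borel)"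
  unfolding cond_density_def joint_density_def case_prod_unfold by measurable

lemma cond_kernel_measurable[measurable]: "cond_kernel U1 U2 \<rho> \<in> measurable borel (subprob_algebra borel)"
proof (rule measurable_subprob_algebra)
  show "subprob_space (cond_kernel U1 U2 \<rho> w)" for w
    by (rule cond_kernel_subprob_space)
  show "sets (cond_kernel U1 U2 \<rho> w) = sets borel" for w
    by (simp add: cond_kernel_def)
  fix B :: "(real^'d2) set" assume [measurable]: "B \<in> sets borel"
  have "emeasure (cond_kernel U1 U2 \<rho> w) B
      = (\<integral>\<^sup>+v. ennreal (cond_density U1 U2 \<rho> w v) * indicator B v \<partial>lborel)" for w
    unfolding cond_kernel_def by (rule emeasure_density) measurable
  then show "(\<lambda>w. emeasure (cond_kernel U1 U2 \<rho> w) B) \<in> borel_measurable borel"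
    by simp
qed

text \<open>
  In rotated coordinates the law of \<open>Z\<close> has the joint density; integrating it over a
  fibre gives the marginal density at \<open>w\<close> times the normalized density, except on the null set of
  \<open>w\<close> where the marginal is infinite.
\<close>
lemma cond_law_of_complement:
  assumes U: "orthogonal_blocks U1 U2" and M: "prob_space M"
    and Z[measurable]: "Z \<in> borel_measurable M"
    and distr: "distr M borel Z = density lborel (\<lambda>x. ennreal (\<rho> x))"
  shows "has_cond_law M borel borel (\<lambda>\<omega>. transpose U1 *v Z \<omega>) (\<lambda>\<omega>. transpose U2 *v Z \<omega>)
    (cond_kernel U1 U2 \<rho>)"
proof -
  interpret prob_space M by fact
  note coords = orthogonal_blocks_coordinates[OF U]
  let ?r = "joint_density U1 U2 \<rho>" and ?K = "cond_kernel U1 U2 \<rho>"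
  note joint_density_measurable[measurable]
  have Z_int: "(\<integral>\<^sup>+\<omega>. g (Z \<omega>) \<partial>M) = (\<integral>\<^sup>+w. (\<integral>\<^sup>+v. ennreal (?r w v) * g (U1 *v w + U2 *v v) \<partial>lborel) \<partial>lborel)"
    if [measurable]: "g \<in> borel_measurable borel" for g :: "real^'d \<Rightarrow> ennreal"
  proof -
    have "(\<integral>\<^sup>+\<omega>. g (Z \<omega>) \<partial>M) = (\<integral>\<^sup>+x. g x \<partial>distr M borel Z)"
      by (simp add: nn_integral_distr)
    also have "\<dots> = (\<integral>\<^sup>+x. \<rho> x * g x \<partial>lborel)"
      unfolding distr by (simp add: nn_integral_density)
    finally show ?thesis
      by (subst (asm) lborel_integral_orthogonal_blocks[OF U]) (simp_all add: joint_density_def)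
  qed
  \<comment> \<open>The marginal density has total mass \<open>1\<close>, so it is finite almost everywhere.\<close>
  have "(\<integral>\<^sup>+w. (\<integral>\<^sup>+v. ennreal (?r w v) \<partial>lborel) \<partial>lborel) = 1"
    using Z_int[of "\<lambda>_. 1"] by (simp add: emeasure_space_1)
  moreover have "(\<lambda>w. \<integral>\<^sup>+v. ennreal (?r w v) \<partial>lborel) \<in> borel_measurable borel"
    unfolding joint_density_def by measurable
  ultimately have fin: "AE w in lborel. (\<integral>\<^sup>+v. ennreal (?r w v) \<partial>lborel) \<noteq> \<infinity>"
    by (intro nn_integral_PInf_AE) auto
  show ?thesis
  proof (rule has_cond_lawI[where E="sets borel"])
    fix A :: "(real^'d1) set" and B :: "(real^'d2) set"
    assume [measurable]: "A \<in> sets borel" and B[measurable]: "B \<in> sets borel"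
    have "emeasure M {\<omega> \<in> space M. transpose U1 *v Z \<omega> \<in> A \<and> transpose U2 *v Z \<omega> \<in> B}
        = (\<integral>\<^sup>+\<omega>. indicator {\<omega> \<in> space M. transpose U1 *v Z \<omega> \<in> A \<and> transpose U2 *v Z \<omega> \<in> B} \<omega> \<partial>M)"
      by (rule nn_integral_indicator[symmetric]) measurable
    also have "\<dots> = (\<integral>\<^sup>+\<omega>. indicator A (transpose U1 *v Z \<omega>) * indicator B (transpose U2 *v Z \<omega>) \<partial>M)"
      by (intro nn_integral_cong) (simp add: indicator_def)
    also have "\<dots> = (\<integral>\<^sup>+w. (\<integral>\<^sup>+v. ennreal (?r w v) * (indicator A w * indicator B v) \<partial>lborel) \<partial>lborel)"
      by (subst Z_int) (simp_all add: coords del: transpose_matrix_vector)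
    also have "\<dots> = (\<integral>\<^sup>+w. indicator A w * (\<integral>\<^sup>+v. ennreal (?r w v) * indicator B v \<partial>lborel) \<partial>lborel)"
      by (simp add: nn_integral_cmult[symmetric] mult_ac)
    also have "\<dots> = (\<integral>\<^sup>+w. indicator A w * ((\<integral>\<^sup>+v. ennreal (?r w v) \<partial>lborel) * emeasure (?K w) B) \<partial>lborel)"
      using fin by (intro nn_integral_cong_AE)
        (elim eventually_mono, simp add: marginal_times_cond_kernel top.not_eq_extremum)
    also have "\<dots> = (\<integral>\<^sup>+w. (\<integral>\<^sup>+v. ennreal (?r w v) * (indicator A w * emeasure (?K w) B) \<partial>lborel) \<partial>lborel)"
      by (simp add: nn_integral_multc, simp add: mult_ac)
    also have "\<dots> = (\<integral>\<^sup>+\<omega>. indicator A (transpose U1 *v Z \<omega>) * emeasure (?K (transpose U1 *v Z \<omega>)) B \<partial>M)"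
      by (subst Z_int) (simp_all add: coords measurable_compose[OF _ measurable_emeasure_kernel[OF cond_kernel_measurable B]]
          del: transpose_matrix_vector)
    finally show "emeasure M {\<omega> \<in> space M. transpose U1 *v Z \<omega> \<in> A \<and> transpose U2 *v Z \<omega> \<in> B}
        = (\<integral>\<^sup>+\<omega>. indicator A (transpose U1 *v Z \<omega>) * emeasure (?K (transpose U1 *v Z \<omega>)) B \<partial>M)" .
  qed (auto simp: sets.sigma_sets_eq[of borel, simplified] sets.Int_stable simp del: transpose_matrix_vector)
qed

text \<open>
  The defining identity of \<open>cond_iid_given\<close>, moved from real integrals to nonnegative ones. The
  factors are probabilities, so integrability is automatic.
\<close>
lemma cond_iid_given_measure:
  assumes iid: "cond_iid_given M W I u (cond_density U1 U2 \<rho>)" and M: "prob_space M"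
    and A: "A \<in> sets borel" and B: "\<And>i. i \<in> I \<Longrightarrow> B i \<in> sets borel"
  shows "emeasure M {\<omega> \<in> space M. W \<omega> \<in> A \<and> (\<forall>i\<in>I. u i \<omega> \<in> B i)}
    = (\<integral>\<^sup>+\<omega>. indicator A (W \<omega>) * (\<Prod>i\<in>I. emeasure (cond_kernel U1 U2 \<rho> (W \<omega>)) (B i)) \<partial>M)"
proof -
  interpret prob_space M by fact
  let ?K = "cond_kernel U1 U2 \<rho>"
  have W[measurable]: "W \<in> borel_measurable M" using iid by (simp add: cond_iid_given_def)
  have K_sub: "subprob_space (?K w)" for w by (rule cond_kernel_subprob_space)
  have [measurable]: "(\<lambda>\<omega>. measure (?K (W \<omega>)) (B i)) \<in> borel_measurable M" if "i \<in> I" for i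
    unfolding measure_def
    using measurable_compose[OF W measurable_emeasure_kernel[OF cond_kernel_measurable B[OF that]]]
    by measurable
  have "emeasure M {\<omega> \<in> space M. W \<omega> \<in> A \<and> (\<forall>i\<in>I. u i \<omega> \<in> B i)}
      = ennreal (\<integral>\<omega>. indicator A (W \<omega>) * (\<Prod>i\<in>I. measure (?K (W \<omega>)) (B i)) \<partial>M)"
    using iid A B by (simp add: emeasure_eq_measure cond_iid_given_def set_integral_cond_density cong: prod.cong)
  also have "\<dots> = (\<integral>\<^sup>+\<omega>. ennreal (indicator A (W \<omega>) * (\<Prod>i\<in>I. measure (?K (W \<omega>)) (B i))) \<partial>M)"
  proof (rule nn_integral_eq_integral[symmetric])
    show "integrable M (\<lambda>\<omega>. indicator A (W \<omega>) * (\<Prod>i\<in>I. measure (?K (W \<omega>)) (B i)))"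
    proof (rule integrable_const_bound[of _ 1])
      show "AE \<omega> in M. norm (indicator A (W \<omega>) * (\<Prod>i\<in>I. measure (?K (W \<omega>)) (B i))) \<le> 1"
        using subprob_space.subprob_measure_le_1[OF K_sub]
        by (intro AE_I2) (auto simp: abs_mult indicator_def abs_prod intro!: prod_le_1)
    qed (use A in measurable)
  qed (simp add: prod_nonneg)
  also have "\<dots> = (\<integral>\<^sup>+\<omega>. indicator A (W \<omega>) * (\<Prod>i\<in>I. emeasure (?K (W \<omega>)) (B i)) \<partial>M)"
  proof (intro nn_integral_cong)
    fix \<omega>
    interpret K: subprob_space "?K (W \<omega>)" by (rule K_sub)
    show "ennreal (indicator A (W \<omega>) * (\<Prod>i\<in>I. measure (?K (W \<omega>)) (B i)))
        = indicator A (W \<omega>) * (\<Prod>i\<in>I. emeasure (?K (W \<omega>)) (B i))"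
      by (simp add: ennreal_mult prod_nonneg prod_ennreal[symmetric] K.emeasure_eq_measure indicator_def)
  qed
  finally show ?thesis .
qed

text \<open>
  For a single sample, or a pair, the remaining samples are left unrestricted; their factors in the
  product are total masses of the kernel and hence \<open>1\<close> for almost every value of \<open>W\<close>.
\<close>
lemma cond_iid_given_has_cond_law:
  assumes iid: "cond_iid_given M W I u (cond_density U1 U2 \<rho>)" and M: "prob_space M"
    and K_prob: "AE \<omega> in M. prob_space (cond_kernel U1 U2 \<rho> (W \<omega>))"
    and I: "finite I" "i \<in> I"
  shows "has_cond_law M borel borel W (u i) (cond_kernel U1 U2 \<rho>)"
proof -
  interpret prob_space M by fact
  let ?K = "cond_kernel U1 U2 \<rho>"
  have [measurable]: "W \<in> borel_measurable M" "u i \<in> borel_measurable M"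
    using iid I by (auto simp: cond_iid_given_def)
  show ?thesis
  proof (rule has_cond_lawI[where E="sets borel"])
    fix A :: "(real^'d1) set" and B :: "(real^'d2) set" assume A: "A \<in> sets borel" and B: "B \<in> sets borel"
    let ?B = "\<lambda>j. if j = i then B else UNIV"
    have "emeasure M {\<omega> \<in> space M. W \<omega> \<in> A \<and> u i \<omega> \<in> B}
        = emeasure M {\<omega> \<in> space M. W \<omega> \<in> A \<and> (\<forall>j\<in>I. u j \<omega> \<in> ?B j)}"
      using I by (intro arg_cong[where f="emeasure M"]) auto
    also have "\<dots> = (\<integral>\<^sup>+\<omega>. indicator A (W \<omega>) * (\<Prod>j\<in>I. emeasure (?K (W \<omega>)) (?B j)) \<partial>M)"
      using B by (intro cond_iid_given_measure[OF iid M A]) auto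
    also have "\<dots> = (\<integral>\<^sup>+\<omega>. indicator A (W \<omega>) * emeasure (?K (W \<omega>)) B \<partial>M)"
    proof (intro nn_integral_cong_AE)
      show "AE \<omega> in M. indicator A (W \<omega>) * (\<Prod>j\<in>I. emeasure (?K (W \<omega>)) (?B j))
          = indicator A (W \<omega>) * emeasure (?K (W \<omega>)) B"
        using K_prob
      proof eventually_elim
        case (elim \<omega>)
        then interpret K: prob_space "?K (W \<omega>)" .
        have "emeasure (?K (W \<omega>)) UNIV = 1"
          using K.emeasure_space_1 by (simp add: cond_kernel_def)
        then have "(\<Prod>j\<in>I. emeasure (?K (W \<omega>)) (?B j)) = (\<Prod>j\<in>{i}. emeasure (?K (W \<omega>)) (?B j))"
          using I by (intro prod.mono_neutral_right) auto
        then show ?case by simp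
      qed
    qed
    finally show "emeasure M {\<omega> \<in> space M. W \<omega> \<in> A \<and> u i \<omega> \<in> B}
        = (\<integral>\<^sup>+\<omega>. indicator A (W \<omega>) * emeasure (?K (W \<omega>)) B \<partial>M)" .
  qed (auto simp: sets.sigma_sets_eq[of borel, simplified] sets.Int_stable)
qed

lemma cond_iid_given_has_pair_cond_law:
  assumes iid: "cond_iid_given M W I u (cond_density U1 U2 \<rho>)" and M: "prob_space M"
    and K_prob: "AE \<omega> in M. prob_space (cond_kernel U1 U2 \<rho> (W \<omega>))"
    and I: "finite I" "i \<in> I" "j \<in> I" "i \<noteq> j"
  shows "has_cond_law M borel (borel \<Otimes>\<^sub>M borel) W (\<lambda>\<omega>. (u i \<omega>, u j \<omega>))
    (\<lambda>w. cond_kernel U1 U2 \<rho> w \<Otimes>\<^sub>M cond_kernel U1 U2 \<rho> w)"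
proof -
  interpret prob_space M by fact
  let ?K = "cond_kernel U1 U2 \<rho>"
  let ?E = "{B \<times> C | B C. B \<in> sets borel \<and> C \<in> sets borel} :: ((real^'d2) \<times> (real^'d2)) set set"
  have [measurable]: "W \<in> borel_measurable M" "u i \<in> borel_measurable M" "u j \<in> borel_measurable M"
    using iid I by (auto simp: cond_iid_given_def)
  show ?thesis
  proof (rule has_cond_lawI[where E="?E"])
    fix A :: "(real^'d1) set" and D :: "((real^'d2) \<times> (real^'d2)) set" assume A: "A \<in> sets borel" and "D \<in> ?E"
    then obtain B C where D: "D = B \<times> C" and B: "B \<in> sets borel" and C: "C \<in> sets borel" by auto
    let ?B = "\<lambda>k. if k = i then B else if k = j then C else UNIV"
    have "emeasure M {\<omega> \<in> space M. W \<omega> \<in> A \<and> (u i \<omega>, u j \<omega>) \<in> D}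
        = emeasure M {\<omega> \<in> space M. W \<omega> \<in> A \<and> (\<forall>k\<in>I. u k \<omega> \<in> ?B k)}"
      using I unfolding D by (intro arg_cong[where f="emeasure M"]) auto
    also have "\<dots> = (\<integral>\<^sup>+\<omega>. indicator A (W \<omega>) * (\<Prod>k\<in>I. emeasure (?K (W \<omega>)) (?B k)) \<partial>M)"
      using B C by (intro cond_iid_given_measure[OF iid M A]) auto
    also have "\<dots> = (\<integral>\<^sup>+\<omega>. indicator A (W \<omega>) * emeasure (?K (W \<omega>) \<Otimes>\<^sub>M ?K (W \<omega>)) D \<partial>M)"
    proof (intro nn_integral_cong_AE)
      show "AE \<omega> in M. indicator A (W \<omega>) * (\<Prod>k\<in>I. emeasure (?K (W \<omega>)) (?B k))
          = indicator A (W \<omega>) * emeasure (?K (W \<omega>) \<Otimes>\<^sub>M ?K (W \<omega>)) D"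
        using K_prob
      proof eventually_elim
        case (elim \<omega>)
        then interpret K: prob_space "?K (W \<omega>)" .
        have "emeasure (?K (W \<omega>)) UNIV = 1"
          using K.emeasure_space_1 by (simp add: cond_kernel_def)
        then have "(\<Prod>k\<in>I. emeasure (?K (W \<omega>)) (?B k)) = (\<Prod>k\<in>{i, j}. emeasure (?K (W \<omega>)) (?B k))"
          using I by (intro prod.mono_neutral_right) auto
        also have "\<dots> = emeasure (?K (W \<omega>)) B * emeasure (?K (W \<omega>)) C"
          using I by auto
        also have "\<dots> = emeasure (?K (W \<omega>) \<Otimes>\<^sub>M ?K (W \<omega>)) D"
          using B C unfolding D by (intro K.emeasure_pair_measure_Times[symmetric]) (simp_all add: cond_kernel_def)
        finally show ?case by simp
      qed
    qed
    finally show "emeasure M {\<omega> \<in> space M. W \<omega> \<in> A \<and> (u i \<omega>, u j \<omega>) \<in> D}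
        = (\<integral>\<^sup>+\<omega>. indicator A (W \<omega>) * emeasure (?K (W \<omega>) \<Otimes>\<^sub>M ?K (W \<omega>)) D \<partial>M)" .
  next
    show "Int_stable ?E" by (rule Int_stable_pair_measure_generator)
    show "sets (borel \<Otimes>\<^sub>M borel) = sigma_sets (space (borel \<Otimes>\<^sub>M borel)) ?E"
      by (simp add: sets_pair_measure space_pair_measure)
    show "space (borel \<Otimes>\<^sub>M borel) \<in> ?E"
      unfolding space_pair_measure space_borel mem_Collect_eq
      by (intro exI[of _ UNIV] conjI refl) simp_all
    show "(\<lambda>w. ?K w \<Otimes>\<^sub>M ?K w) \<in> measurable borel (subprob_algebra (borel \<Otimes>\<^sub>M borel))"
      by (intro measurable_pair_measure cond_kernel_measurable)
  qed (auto simp: space_pair_measure)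
qed

end

section \<open>The error bound\<close>

theorem theorem3p5:
  fixes P :: "(real^'d) measure"
    and F :: "'d \<Rightarrow> real \<Rightarrow> real"
    and \<rho> :: "real^'d \<Rightarrow> real"
    and \<Omega> :: "(real^'d) set"
    and f :: "real^'d \<Rightarrow> real"
    and U1 :: "real^'d1^'d"
    and U2 :: "real^'d2^'d"
    and M :: "'w measure"
    and Z :: "'w \<Rightarrow> real^'d"
    and N1 :: nat
    and u :: "nat \<Rightarrow> 'w \<Rightarrow> real^'d2"
  assumes "product_distribution P F \<rho>"
    and "\<Omega> \<in> sets borel" and "measure P \<Omega> = 1"
    and "square_integrable_on P \<Omega> f"
    and "orthogonal_blocks U1 U2"
    and "N1 \<ge> 1"
    and "prob_space M"
    and "Z \<in> borel_measurable M" and "distr M borel Z = P"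
    and "cond_iid_given M (\<lambda>\<omega>. transpose U1 *v Z \<omega>) {1..N1} u (cond_density U1 U2 \<rho>)"
    and "\<And>\<omega>. \<omega> \<in> space M \<Longrightarrow> Z \<omega> \<in> \<Omega>"
    and "\<And>\<omega> i. \<omega> \<in> space M \<Longrightarrow> i \<in> {1..N1} \<Longrightarrow>
           U1 *v (transpose U1 *v Z \<omega>) + U2 *v u i \<omega> \<in> \<Omega>"
  shows "integrable M (\<lambda>\<omega>. (F_mc U1 U2 f N1 (\<lambda>i. u i \<omega>) (Z \<omega>) - f (Z \<omega>))\<^sup>2) \<and>
         integrable M (\<lambda>\<omega>. (F_gas U1 U2 \<rho> \<Omega> f (Z \<omega>) - f (Z \<omega>))\<^sup>2) \<and>
         sqrt (\<integral>\<omega>. (F_mc U1 U2 f N1 (\<lambda>i. u i \<omega>) (Z \<omega>) - f (Z \<omega>))\<^sup>2 \<partial>M)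
         \<le> (1 + 1 / sqrt (real N1)) *
            sqrt (\<integral>\<omega>. (F_gas U1 U2 \<rho> \<Omega> f (Z \<omega>) - f (Z \<omega>))\<^sup>2 \<partial>M)"
proof -
  note U = \<open>orthogonal_blocks U1 U2\<close> and iid = assms(10) and Z_in = assms(11) and sample_in = assms(12)
  interpret prob_space M by fact
  have \<rho>[measurable]: "\<rho> \<in> borel_measurable borel" and \<rho>_nonneg: "\<And>x. 0 \<le> \<rho> x"
    and P: "P = density lborel (\<lambda>x. ennreal (\<rho> x))"
    using assms(1) by (auto simp: product_distribution_def)
  have \<Omega>[measurable]: "\<Omega> \<in> sets borel" by fact
  have Z[measurable]: "Z \<in> borel_measurable M" by fact
  let ?K = "cond_kernel U1 U2 \<rho>"
  define W where "W \<omega> = transpose U1 *v Z \<omega>" for \<omega>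
  define X where "X \<omega> = transpose U2 *v Z \<omega>" for \<omega>
  \<comment> \<open>Extension of \<open>f\<close> by \<open>0\<close>, a measurable function on the whole space. All evaluation points lie in
    \<open>\<Omega>\<close>, and the integral in \<open>F_gas\<close> runs over \<open>\<Omega>\<close> only, so \<open>f\<close> may be replaced by it.\<close>
  define f0 where "f0 x = f x * indicator \<Omega> x" for x
  define h where "h = (\<lambda>(w, v). f0 (U1 *v w + U2 *v v))"
  have W[measurable]: "W \<in> borel_measurable M" and X[measurable]: "X \<in> borel_measurable M"
    unfolding W_def X_def by measurable
  have u[measurable]: "i \<in> {1..N1} \<Longrightarrow> u i \<in> borel_measurable M" for i
    using iid by (simp add: cond_iid_given_def)
  have f0[measurable]: "f0 \<in> borel_measurable borel"
    using assms(4) unfolding square_integrable_on_def f0_def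
    by (subst (asm) borel_measurable_restrict_space_iff) (auto simp: mult.commute)
  have h[measurable]: "h \<in> borel_measurable (borel \<Otimes>\<^sub>M borel)"
    unfolding h_def by measurable
  have K: "?K \<in> measurable borel (subprob_algebra borel)"
    by (rule cond_kernel_measurable[OF \<rho> \<rho>_nonneg])
  have law: "has_cond_law M borel borel W X ?K"
    unfolding W_def X_def
    using assms(9) by (intro cond_law_of_complement[OF \<rho> \<rho>_nonneg U]) (simp_all add: P prob_space_axioms)
  note K_prob = has_cond_law_imp_AE_prob_space[OF W K law]
  note iid_W = iid[folded W_def]
  have hZ: "h (W \<omega>, X \<omega>) = f (Z \<omega>)" if "\<omega> \<in> space M" for \<omega>
    using Z_in[OF that] orthogonal_blocks_coordinates(3)[OF U, of "Z \<omega>"]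
    by (simp add: h_def W_def X_def f0_def del: transpose_matrix_vector)
  have mc: "(\<Sum>i\<in>{1..N1}. h (W \<omega>, u i \<omega>)) / card {1..N1} = F_mc U1 U2 f N1 (\<lambda>i. u i \<omega>) (Z \<omega>)"
    if "\<omega> \<in> space M" for \<omega>
    using sample_in[OF that] by (simp add: F_mc_def h_def W_def f0_def del: transpose_matrix_vector)
  have gas: "(\<integral>v. h (W \<omega>, v) \<partial>?K (W \<omega>)) = F_gas U1 U2 \<rho> \<Omega> f (Z \<omega>)" for \<omega>
  proof -
    have [measurable]: "(\<lambda>v. h (W \<omega>, v)) \<in> borel_measurable borel"
      unfolding h_def by simp
    have [measurable]: "(\<lambda>v. cond_density U1 U2 \<rho> (W \<omega>) v) \<in> borel_measurable borel"
      using measurable_compose[OF _ cond_density_measurable[OF \<rho> \<rho>_nonneg, of U1 U2], of "\<lambda>v. (W \<omega>, v)"] by simp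
    have "(\<integral>v. h (W \<omega>, v) \<partial>?K (W \<omega>)) = (\<integral>v. cond_density U1 U2 \<rho> (W \<omega>) v * h (W \<omega>, v) \<partial>lborel)"
      unfolding cond_kernel_def
      by (subst integral_density) (simp_all add: cond_density_nonneg[OF \<rho> \<rho>_nonneg])
    also have "\<dots> = F_gas U1 U2 \<rho> \<Omega> f (Z \<omega>)"
      unfolding F_gas_def Let_def set_lebesgue_integral_def W_def[symmetric]
      by (rule Bochner_Integration.integral_cong) (simp_all add: h_def f0_def indicator_def)
    finally show ?thesis .
  qed
  have f0_sq: "(f0 x)\<^sup>2 = indicator \<Omega> x *\<^sub>R (f x)\<^sup>2" for x
    by (simp add: f0_def indicator_def)
  have "integrable P (\<lambda>x. (f0 x)\<^sup>2)"
    using assms(4) unfolding square_integrable_on_def set_integrable_def f0_sq by simp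
  then have "integrable M (\<lambda>\<omega>. (f0 (Z \<omega>))\<^sup>2)"
    unfolding assms(9)[symmetric] by (subst (asm) integrable_distr_eq) auto
  then have sq: "integrable M (\<lambda>\<omega>. (h (W \<omega>, X \<omega>))\<^sup>2)"
    using orthogonal_blocks_coordinates(3)[OF U] by (simp add: h_def W_def X_def del: transpose_matrix_vector)
  let ?mc = "\<lambda>\<omega>. ((\<Sum>i\<in>{1..N1}. h (W \<omega>, u i \<omega>)) / card {1..N1} - h (W \<omega>, X \<omega>))\<^sup>2"
  let ?mc' = "\<lambda>\<omega>. (F_mc U1 U2 f N1 (\<lambda>i. u i \<omega>) (Z \<omega>) - f (Z \<omega>))\<^sup>2"
  let ?gas = "\<lambda>\<omega>. ((\<integral>v. h (W \<omega>, v) \<partial>?K (W \<omega>)) - h (W \<omega>, X \<omega>))\<^sup>2"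
  let ?gas' = "\<lambda>\<omega>. (F_gas U1 U2 \<rho> \<Omega> f (Z \<omega>) - f (Z \<omega>))\<^sup>2"
  have mc_cong: "?mc \<omega> = ?mc' \<omega>" and gas_cong: "?gas \<omega> = ?gas' \<omega>" if "\<omega> \<in> space M" for \<omega>
    using that by (simp_all only: mc gas hZ)
  have N1: "finite {1..N1}" "{1..N1} \<noteq> {}" using \<open>N1 \<ge> 1\<close> by simp_all
  note sample_law = cond_iid_given_has_cond_law[OF \<rho> \<rho>_nonneg iid_W prob_space_axioms K_prob N1(1)]
  note sample_pair_law =
    cond_iid_given_has_pair_cond_law[OF \<rho> \<rho>_nonneg iid_W prob_space_axioms K_prob N1(1)]
  note error = sample_mean_error[OF W X u K h N1 law sample_law sample_pair_law sq]
  have mc_int: "integrable M ?mc" and gas_int: "integrable M ?gas"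
    and le: "sqrt (\<integral>\<omega>. ?mc \<omega> \<partial>M) \<le> (1 + 1 / sqrt (card {1..N1})) * sqrt (\<integral>\<omega>. ?gas \<omega> \<partial>M)"
    by (rule error; assumption)+
  have mc_eq: "(\<integral>\<omega>. ?mc \<omega> \<partial>M) = (\<integral>\<omega>. ?mc' \<omega> \<partial>M)"
    by (rule Bochner_Integration.integral_cong[OF refl]) (rule mc_cong)
  have gas_eq: "(\<integral>\<omega>. ?gas \<omega> \<partial>M) = (\<integral>\<omega>. ?gas' \<omega> \<partial>M)"
    by (rule Bochner_Integration.integral_cong[OF refl]) (rule gas_cong)
  show ?thesis
  proof (intro conjI)
    show "integrable M ?mc'"
      by (rule Bochner_Integration.integrable_cong[THEN iffD1, OF refl _ mc_int]) (rule mc_cong)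
    show "integrable M ?gas'"
      by (rule Bochner_Integration.integrable_cong[THEN iffD1, OF refl _ gas_int]) (rule gas_cong)
    show "sqrt (\<integral>\<omega>. ?mc' \<omega> \<partial>M) \<le> (1 + 1 / sqrt (real N1)) * sqrt (\<integral>\<omega>. ?gas' \<omega> \<partial>M)"
      using le unfolding mc_eq gas_eq unfolding card_atLeastAtMost diff_Suc_1 .
  qed
qed

end
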